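(* Suppose that Assumptions (A1), (A2) and (A3) (stated in the context) hold, and let $\{x_k\}_{k\in\mathbb{N}}$ be the sequence of iterates generated by the trust-region algorithm described in the context. Then $$\lim_{k\to\infty}\pi_k^f=0,\qquad\text{where}\quad \pi_k^f=\Big|\min_{\substack{x_k+d\in\Omega\\ \|d\|_{\mathrm{tr}}\le 1}}\nabla f(x_k)^Td\Big| .$$
   Context: Notation. $\mathbb{N}=\{0,1,\dots\}$, $[p]=\{1,\dots,p\}$. $\mathrm{tr}\ge1$ is a fixed real number, $\|\cdot\|_{\mathrm{tr}}$ is the $\ell_{\mathrm{tr}}$-norm on $\mathbb{R}^{n_x}$, $B_{\mathrm{tr}}(x,\Delta)$ its closed ball, $\|z\|_{\mathrm{tr}^*}=\max\{z^Tx:\|x\|_{\mathrm{tr}}\le1\}$, and $\|M\|_{(\mathrm{tr},\mathrm{tr}^* )}=\sup_{\|x\|_{\mathrm{tr}}\le1}\|Mx\|_{\mathrm{tr}^*}$. For vector-valued $G$, $\nabla G$ is the transpose of the Jacobian. Problem. Minimize $f(x)=h(F(x))$ over $\Omega=[x_L,x_U]\subseteq\mathbb{R}^{n_x}$ (componentwise bounds, possibly infinite, $x_{L,j}<x_{U,j}$), where $F=(F_1,\dots,F_p)^T:\mathbb{R}^{n_x}\to\mathbb{R}^p$ and $h:\mathbb{R}^p\to\mathbb{R}$. Given $x_0\in\Omega$ and $\Delta_{\max}>0$, let $\mathcal{L}_0=\{x:f(x)\le f(x_0)\}$ and $\mathcal{L}_{\mathrm{enl}}=\mathcal{L}_0+B_{\mathrm{tr}}(0,\Delta_{\max})$.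 Assumptions. There are an open convex $\mathcal{X}\supseteq\mathcal{L}_{\mathrm{enl}}\cap\Omega$ and an open convex $\mathcal{Y}\subseteq\mathbb{R}^p$ containing $\{F(x):x\in\mathcal{L}_{\mathrm{enl}}\cap\Omega\}$ and $\bigcup_{k\in\mathbb{N}}\{q_k(x):x\in\mathcal{L}_{\mathrm{enl}}\cap\Omega\}$ ($q_k=(q_{k,1},\dots,q_{k,p})^T$ being the models of the algorithm) such that: (A1) On $\mathcal{X}$ each $F_i$ is continuously differentiable, $|F_i(x)-F_i(\bar x)|\le L_{F_i,x}\|x-\bar x\|_{\mathrm{tr}}$ and $\|\nabla F_i(x)-\nabla F_i(\bar x)\|_{\mathrm{tr}^*}\le L_{\nabla F_i,x}\|x-\bar x\|_{\mathrm{tr}}$. On $\mathcal{Y}$, $h$ is twice continuously differentiable, $h$ and $\nabla h$ are Lipschitz in $\|\cdot\|_2$ with constants $L_h$, $L_{\nabla h}$, $\|\nabla h\|_2\le\kappa_{\nabla h}$ and, for each $i\in[p]$, $|\partial_ih|\le\kappa_{\partial_ih}$. (A2) On $\mathcal{X}$, for all $k\in\mathbb{N}$, $i\in[p]$, $q_{k,i}$ is twice continuously differentiable, $\|\nabla q_{k,i}(x)-\nabla q_{k,i}(\bar x)\|_{\mathrm{tr}^*}\le L_{\nabla q_i}\|x-\bar x\|_{\mathrm{tr}}$ and $\|\nabla q_{k,i}(x)\|_2\le\kappa_{\nabla q_i}$, with constants independent of $k$. (A3) $f$ is bounded below on $\mathcal{L}_{\mathrm{enl}}\cap\Omega$. All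 constants are positive reals. Algorithm. Parameters: $\Delta_{\max}\in(0,\infty)$, $\Delta_0\in(0,\Delta_{\max}]$, $\gamma_{\mathrm{dec}}\in(0,1)$, $\gamma_{\mathrm{inc}}\in(1,\infty)$, $\eta\in(0,\infty)$, $\mu,\epsilon_c,\kappa_{\mathrm{app}},\Lambda\in(0,\infty)$, $c_{\mathrm{app}}\in[0,\infty)$, $\kappa_{\mathrm{fcd}}\in(0,1]$, $x_0\in\Omega$. For $k=0,1,\dots$: 1. $\delta_k=c_{\mathrm{app}}\Delta_k^2$. 2. Find $\mathcal{D}_k=\{d_1,\dots,d_{n_x}\}\subset B_{\mathrm{tr}}(0,\Delta_k)\cap(\Omega-x_k)$ with $[d_1\cdots d_{n_x}]$ invertible and $\|[d_1\cdots d_{n_x}]^{-1}\|_2\le\Lambda/\Delta_k$; obtain real numbers $\tilde F_i(x_k+d,\delta_k)$ with $|F_i(x_k+d)-\tilde F_i(x_k+d,\delta_k)|\le\kappa_{\mathrm{app}}\delta_k$ for all $d\in\mathcal{D}_k\cup\{0\}$, $i\in[p]$; and models $q_{k,i}$ satisfying (A2) with $q_{k,i}(x_k+d)=\tilde F_i(x_k+d,\delta_k)$ for all $d\in\mathcal{D}_k\cup\{0\}$. Set $m_k(x)=h(q_k(x_k))+\nabla h(q_k(x_k))^T\nabla q_k(x_k)^T(x-x_k)+\tfrac12(x-x_k)^TH_k(x-x_k)$, $H_k=\sum_{i=1}^p\partial_ih(q_k(x_k))\nabla^2q_{k,i}(x_k)+\nabla q_k(x_k)\nabla^2h(q_k(x_k))\nabla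 q_k(x_k)^T$, and $\pi_k^m=\big|\min\{\nabla m_k(x_k)^Td:x_k+d\in\Omega,\|d\|_{\mathrm{tr}}\le1\}\big|$. 3. If $\pi_k^m\le\epsilon_c$ and $\Delta_k>\mu\pi_k^m$ (criticality step): $s_k=0$, $\rho_k=0$, $\Delta_{k+1}=\gamma_{\mathrm{dec}}\Delta_k$, $x_{k+1}=x_k$. 4. Otherwise compute $s_k$ with $\|s_k\|_{\mathrm{tr}}\le\Delta_k$, $x_k+s_k\in\Omega$ and $m_k(x_k)-m_k(x_k+s_k)\ge\kappa_{\mathrm{fcd}}\pi_k^m\min\{\pi_k^m/(\kappa_{\mathrm{bhm}}+1),\Delta_k,1\}$, and set $\rho_k=\frac{f(x_k)-f(x_k+s_k)}{m_k(x_k)-m_k(x_k+s_k)}$. If $\rho_k\ge\eta$ (successful step): $\Delta_{k+1}=\min\{\gamma_{\mathrm{inc}}\Delta_k,\Delta_{\max}\}$, $x_{k+1}=x_k+s_k$. Else (unsuccessful step): $\Delta_{k+1}=\gamma_{\mathrm{dec}}\Delta_k$, $x_{k+1}=x_k$. Here $\kappa_{\mathrm{bhm}}>0$ is a constant with $\|\nabla^2m_k(x_k)\|_{(\mathrm{tr},\mathrm{tr}^* )}\le\kappa_{\mathrm{bhm}}$ for all $k$ (one exists under (A2)).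
   Formalization: The acceptance parameter η is restricted to 0 < η < 1 instead of η in (0,∞), because for every η ≥ 1 the claim fails (every step can be unsuccessful, so the iterates never move). *)

theory Defs
  imports "HOL-Analysis.Analysis"
begin

text \<open>The suprema below, and the infimum in the criticality measure, are taken over nonempty compact
  sets and are therefore attained, i.e. they are the maxima and minima of the usual definitions.\<close>

definition tr_norm :: "real \<Rightarrow> real ^ 'n \<Rightarrow> real" where
  "tr_norm tr x = (\<Sum>j\<in>UNIV. \<bar>x $ j\<bar> powr tr) powr (1 / tr)"

definition tr_dual_norm :: "real \<Rightarrow> real ^ 'n \<Rightarrow> real" where
  "tr_dual_norm tr z = (SUP x\<in>{x. tr_norm tr x \<le> 1}. z \<bullet> x)"

definition tr_op_norm :: "real \<Rightarrow> real ^ 'n ^ 'n \<Rightarrow> real" where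
  "tr_op_norm tr M = (SUP x\<in>{x. tr_norm tr x \<le> 1}. tr_dual_norm tr (M *v x))"

definition grad :: "(real ^ 'n \<Rightarrow> real) \<Rightarrow> real ^ 'n \<Rightarrow> real ^ 'n" where
  "grad f x = (\<chi> j. frechet_derivative f (at x) (axis j 1))"

definition hess :: "(real ^ 'n \<Rightarrow> real) \<Rightarrow> real ^ 'n \<Rightarrow> real ^ 'n ^ 'n" where
  "hess f x = jacobian (grad f) (at x)"

text \<open>For vector-valued functions the gradient is the transposed Jacobian: its \<open>i\<close>-th column is the
  gradient of the \<open>i\<close>-th component.\<close>

definition vgrad :: "(real ^ 'n \<Rightarrow> real ^ 'p) \<Rightarrow> real ^ 'n \<Rightarrow> real ^ 'p ^ 'n" where
  "vgrad G x = transpose (jacobian G (at x))"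

text \<open>The next two notions are only used on open sets \<open>S\<close>.\<close>

definition C1_on :: "(real ^ 'n) set \<Rightarrow> (real ^ 'n \<Rightarrow> real) \<Rightarrow> bool" where
  "C1_on S f \<longleftrightarrow> (\<forall>x\<in>S. f differentiable (at x)) \<and> continuous_on S (grad f)"

definition C2_on :: "(real ^ 'n) set \<Rightarrow> (real ^ 'n \<Rightarrow> real) \<Rightarrow> bool" where
  "C2_on S f \<longleftrightarrow> C1_on S f \<and> (\<forall>x\<in>S. grad f differentiable (at x)) \<and> continuous_on S (hess f)"

definition bound_box :: "('n \<Rightarrow> ereal) \<Rightarrow> ('n \<Rightarrow> ereal) \<Rightarrow> (real ^ 'n) set" where
  "bound_box xL xU = {x. \<forall>j. xL j \<le> ereal (x $ j) \<and> ereal (x $ j) \<le> xU j}"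

definition enlarged_level_set :: "real \<Rightarrow> real \<Rightarrow> (real ^ 'n \<Rightarrow> real) \<Rightarrow> real ^ 'n \<Rightarrow> (real ^ 'n) set" where
  "enlarged_level_set tr r f x0 = {y + z | y z. f y \<le> f x0 \<and> tr_norm tr z \<le> r}"

text \<open>Criticality measure at \<open>x\<close> over the feasible set \<open>S\<close>, for a function whose gradient
  at \<open>x\<close> is \<open>g\<close>.\<close>

definition crit_measure :: "real \<Rightarrow> (real ^ 'n) set \<Rightarrow> real ^ 'n \<Rightarrow> real ^ 'n \<Rightarrow> real" where
  "crit_measure tr S g x = \<bar>INF d\<in>{d. x + d \<in> S \<and> tr_norm tr d \<le> 1}. g \<bullet> d\<bar>"

text \<open>The curvature matrix and quadratic model obtained at \<open>xk\<close> from the outer function \<open>h\<close>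
  and the model \<open>Q\<close> of the inner function.\<close>

definition model_hess ::
  "(real ^ 'p \<Rightarrow> real) \<Rightarrow> (real ^ 'n \<Rightarrow> real ^ 'p) \<Rightarrow> real ^ 'n \<Rightarrow> real ^ 'n ^ 'n" where
  "model_hess h Q xk =
     (\<Sum>i\<in>UNIV. (grad h (Q xk) $ i) *\<^sub>R hess (\<lambda>y. Q y $ i) xk)
     + vgrad Q xk ** hess h (Q xk) ** transpose (vgrad Q xk)"

definition quad_model ::
  "(real ^ 'p \<Rightarrow> real) \<Rightarrow> (real ^ 'n \<Rightarrow> real ^ 'p) \<Rightarrow> real ^ 'n \<Rightarrow> real ^ 'n \<Rightarrow> real" where
  "quad_model h Q xk x =
     h (Q xk) + grad h (Q xk) \<bullet> (transpose (vgrad Q xk) *v (x - xk))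
     + 1 / 2 * ((x - xk) \<bullet> (model_hess h Q xk *v (x - xk)))"

definition column_matrix :: "('n \<Rightarrow> real ^ 'n) \<Rightarrow> real ^ 'n ^ 'n" where
  "column_matrix d = (\<chi> i j. d j $ i)"

end

theory Submission
  imports Defs
begin

text \<open>Every successful step has \<open>\<pi>\<^sup>m \<ge> min \<epsilon>\<^sub>c (\<Delta> / \<mu>)\<close>, by the criticality test, and therefore decreases
  \<open>f\<close> by an amount bounded below by an increasing positive function of \<open>\<Delta>\<close>. Since \<open>f\<close> is bounded
  below, \<open>\<Delta>\<^sub>k\<close> tends to \<open>0\<close>. The interpolation conditions give
  \<open>\<bar>\<pi>\<^sup>f - \<pi>\<^sup>m\<bar> = O(\<Delta>)\<close>, and the model error is \<open>O(\<Delta>\<^sup>2)\<close>, so where \<open>\<pi>\<^sup>m\<close> stays away from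
  \<open>0\<close> all late steps are successful. As successful steps do not shrink \<open>\<Delta>\<close>, \<open>\<pi>\<^sup>f\<close> gets
  arbitrarily small infinitely often. Finally \<open>\<pi>\<^sup>f\<close> changes by \<open>O(\<Delta>)\<close> per step, and while
  \<open>\<pi>\<^sup>f \<ge> \<epsilon>\<close> this is at most a constant times the decrease of \<open>f\<close>; as the decreases are
  summable, \<open>\<pi>\<^sup>f\<close> cannot climb again.\<close>

section \<open>The trust-region norm, its dual and its operator norm against the Euclidean
  norm\<close>

lemma tr_norm_nonneg: "0 \<le> tr_norm tr x"
  by (simp add: tr_norm_def)

lemma tr_norm_mono:
  assumes "tr \<ge> 1" "\<And>j. \<bar>x $ j\<bar> \<le> \<bar>y $ j\<bar>"
  shows "tr_norm tr x \<le> tr_norm tr y"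
  unfolding tr_norm_def using assms
  by (intro powr_mono2 sum_mono sum_nonneg) auto

lemma tr_norm_scaleR:
  assumes "tr \<ge> 1"
  shows "tr_norm tr (c *\<^sub>R x) = \<bar>c\<bar> * tr_norm tr x"
proof -
  have "(\<Sum>j\<in>UNIV. \<bar>(c *\<^sub>R x) $ j\<bar> powr tr) = \<bar>c\<bar> powr tr * (\<Sum>j\<in>UNIV. \<bar>x $ j\<bar> powr tr)"
    by (simp add: abs_mult powr_mult sum_distrib_left)
  then show ?thesis
    using assms by (simp add: tr_norm_def powr_mult powr_powr sum_nonneg)
qed

lemma tr_norm_zero: "tr \<ge> 1 \<Longrightarrow> tr_norm tr 0 = 0"
  by (simp add: tr_norm_def)

lemma component_le_tr_norm:
  assumes "tr \<ge> 1"
  shows "\<bar>x $ j\<bar> \<le> tr_norm tr x"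
proof -
  have "\<bar>x $ j\<bar> = (\<bar>x $ j\<bar> powr tr) powr (1 / tr)"
    using assms by (simp add: powr_powr)
  also have "\<dots> \<le> tr_norm tr x"
    unfolding tr_norm_def using assms
    by (intro powr_mono2 member_le_sum) auto
  finally show ?thesis .
qed

text \<open>Goes through the l1 norm, each component being at most \<open>tr_norm tr x\<close>. The
  factor \<open>CARD('n)\<close> is crude but serves every \<open>tr \<ge> 1\<close> at
  once.\<close>

lemma norm_le_tr_norm:
  fixes x :: "real ^ 'n"
  assumes "tr \<ge> 1"
  shows "norm x \<le> real CARD('n) * tr_norm tr x"
proof -
  have "norm x \<le> (\<Sum>j\<in>UNIV. \<bar>x $ j\<bar>)"
    by (rule norm_le_l1_cart)
  also have "\<dots> \<le> real CARD('n) * tr_norm tr x"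
    using sum_bounded_above[of UNIV "\<lambda>j. \<bar>x $ j\<bar>" "tr_norm tr x"] component_le_tr_norm[OF assms, of x]
    by simp
  finally show ?thesis .
qed

lemma tr_norm_le_norm:
  fixes x :: "real ^ 'n"
  assumes "tr \<ge> 1"
  shows "tr_norm tr x \<le> real CARD('n) * norm x"
proof -
  have n: "1 \<le> real CARD('n)" by simp
  have "(\<Sum>j\<in>UNIV. \<bar>x $ j\<bar> powr tr) \<le> real CARD('n) * norm x powr tr"
    using sum_bounded_above[of UNIV "\<lambda>j. \<bar>x $ j\<bar> powr tr" "norm x powr tr"] assms
    by (simp add: powr_mono2 component_le_norm_cart)
  then have "tr_norm tr x \<le> (real CARD('n) * norm x powr tr) powr (1 / tr)"
    unfolding tr_norm_def using assms by (intro powr_mono2) (auto intro: sum_nonneg)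
  also have "\<dots> = real CARD('n) powr (1 / tr) * norm x"
    using assms by (simp add: powr_mult powr_powr)
  also have "\<dots> \<le> real CARD('n) powr 1 * norm x"
    using assms n by (intro mult_right_mono powr_mono) auto
  finally show ?thesis by simp
qed

text \<open>Bounds the set under the supremum in \<open>tr_dual_norm\<close>, without which
  \<open>SUP\<close> over the reals would say nothing. The infimum in \<open>crit_measure\<close> is
  controlled in the same way.\<close>

lemma inner_le_tr_dual_norm_bound:
  fixes z x :: "real ^ 'n"
  assumes "tr \<ge> 1" "tr_norm tr x \<le> 1"
  shows "z \<bullet> x \<le> norm z * real CARD('n)"
proof -
  have "z \<bullet> x \<le> norm z * norm x" by (rule norm_cauchy_schwarz)
  also have "norm x \<le> real CARD('n)"
    using norm_le_tr_norm[OF assms(1), of x] assms(2)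
    by (smt (verit) mult_left_le of_nat_0_le_iff)
  finally show ?thesis by (simp add: mult_left_mono)
qed

lemma tr_dual_norm_le:
  fixes z :: "real ^ 'n"
  assumes "tr \<ge> 1"
  shows "tr_dual_norm tr z \<le> norm z * real CARD('n)"
  unfolding tr_dual_norm_def
  by (rule cSUP_least) (auto intro!: inner_le_tr_dual_norm_bound assms exI[of _ 0] simp: tr_norm_zero assms)

lemma inner_le_tr_dual_norm:
  fixes z :: "real ^ 'n"
  assumes "tr \<ge> 1" "tr_norm tr x \<le> 1"
  shows "z \<bullet> x \<le> tr_dual_norm tr z"
  unfolding tr_dual_norm_def using assms
  by (intro cSUP_upper) (auto intro!: bdd_aboveI2[where M = "norm z * real CARD('n)"] inner_le_tr_dual_norm_bound)

lemma norm_le_tr_dual_norm: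
  fixes z :: "real ^ 'n"
  assumes "tr \<ge> 1"
  shows "norm z \<le> real CARD('n) * tr_dual_norm tr z"
proof (cases "z = 0")
  case True
  then show ?thesis using inner_le_tr_dual_norm[OF assms, of 0 z] by (simp add: tr_norm_zero assms)
next
  case False
  \<comment> \<open>The test vector is \<open>z\<close> itself, shrunk into the unit ball with the
    help of \<open>tr_norm_le_norm\<close>.\<close>
  define x where "x = (1 / (real CARD('n) * norm z)) *\<^sub>R z"
  have pos: "real CARD('n) * norm z > 0" using False by simp
  have "tr_norm tr x = tr_norm tr z / (real CARD('n) * norm z)"
    using assms pos by (simp add: x_def tr_norm_scaleR)
  also have "\<dots> \<le> 1" using tr_norm_le_norm[OF assms, of z] pos by simp
  finally have "z \<bullet> x \<le> tr_dual_norm tr z" by (rule inner_le_tr_dual_norm[OF assms])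
  moreover have "z \<bullet> x = norm z / real CARD('n)"
    using False by (simp add: x_def power2_norm_eq_inner[symmetric] power2_eq_square)
  ultimately show ?thesis by (simp add: divide_simps mult.commute)
qed

text \<open>Rescaling moves \<open>v\<close> into the unit ball, and testing the dual norm of
  \<open>M *v u\<close> with both \<open>u\<close> and \<open>- u\<close> yields the absolute value.
  Dividing by the bound \<open>r\<close> instead of the norm of \<open>v\<close> avoids a separate
  case \<open>v = 0\<close>.\<close>

lemma quadratic_form_le_tr_op_norm:
  fixes M :: "real ^ 'n ^ 'n"
  assumes "tr \<ge> 1" "tr_op_norm tr M \<le> K" "tr_norm tr v \<le> r" "r > 0"
  shows "\<bar>v \<bullet> (M *v v)\<bar> \<le> K * r\<^sup>2"
proof -
  define u where "u = (1 / r) *\<^sub>R v"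
  have v: "v = r *\<^sub>R u" using assms(4) by (simp add: u_def)
  have u: "tr_norm tr u \<le> 1" "tr_norm tr (- u) \<le> 1"
    using assms tr_norm_scaleR[OF assms(1), of "-1" u] by (auto simp: u_def tr_norm_scaleR)
  have bl: "bounded_linear ((*v) M)" by (rule matrix_vector_mul_bounded_linear)
  \<comment> \<open>Boundedness above, so that the supremum in \<open>tr_op_norm\<close> dominates
    its members.\<close>
  have "tr_dual_norm tr (M *v y) \<le> onorm ((*v) M) * real CARD('n) * real CARD('n)"
    if "tr_norm tr y \<le> 1" for y
  proof -
    have "norm y \<le> real CARD('n)"
      using norm_le_tr_norm[OF assms(1), of y] that by (smt (verit) mult_left_le of_nat_0_le_iff)
    then have "norm (M *v y) \<le> onorm ((*v) M) * real CARD('n)"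
      using onorm[OF bl, of y] onorm_pos_le[OF bl] by (meson mult_left_mono order_trans)
    then show ?thesis
      using tr_dual_norm_le[OF assms(1), of "M *v y"] by (meson mult_right_mono of_nat_0_le_iff order_trans)
  qed
  then have "bdd_above ((\<lambda>y. tr_dual_norm tr (M *v y)) ` {y. tr_norm tr y \<le> 1})"
    by (intro bdd_aboveI2) auto
  then have "tr_dual_norm tr (M *v u) \<le> K"
    using cSUP_upper[of u "{y. tr_norm tr y \<le> 1}" "\<lambda>y. tr_dual_norm tr (M *v y)"] u assms(2)
    unfolding tr_op_norm_def by simp
  then have "\<bar>u \<bullet> (M *v u)\<bar> \<le> K"
    using inner_le_tr_dual_norm[OF assms(1) u(1), of "M *v u"]
      inner_le_tr_dual_norm[OF assms(1) u(2), of "M *v u"] by (simp add: inner_commute abs_le_iff)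
  moreover have "v \<bullet> (M *v v) = r\<^sup>2 * (u \<bullet> (M *v u))"
    by (simp add: v power2_eq_square matrix_vector_mult_scaleR)
  ultimately show ?thesis
    using mult_left_mono[of "\<bar>u \<bullet> (M *v u)\<bar>" K "r\<^sup>2"] by (simp add: abs_mult mult.commute)
qed

section \<open>Gradients and first-order Taylor bounds\<close>

lemma has_derivative_grad:
  assumes "f differentiable (at x)"
  shows "(f has_derivative (\<lambda>v. grad f x \<bullet> v)) (at x)"
proof -
  let ?D = "frechet_derivative f (at x)"
  have D: "(f has_derivative ?D) (at x)"
    using assms by (simp add: frechet_derivative_works)
  then have lin: "linear ?D" by (rule has_derivative_linear)
  have "?D v = grad f x \<bullet> v" for v
  proof -
    have "?D v = ?D (\<Sum>j\<in>UNIV. v $ j *s axis j 1)" by (simp add: basis_expansion)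
    also have "\<dots> = (\<Sum>j\<in>UNIV. v $ j * ?D (axis j 1))"
      by (simp add: linear_sum[OF lin] linear_scale[OF lin] scalar_mult_eq_scaleR)
    finally show ?thesis by (simp add: grad_def inner_vec_def mult.commute)
  qed
  then have "?D = (\<lambda>v. grad f x \<bullet> v)" by blast
  with D show ?thesis by simp
qed

lemma grad_eqI:
  assumes "(f has_derivative (\<lambda>v. g \<bullet> v)) (at x)"
  shows "grad f x = g"
  by (simp add: grad_def inner_axis frechet_derivative_at[OF assms, symmetric])

text \<open>The mean value inequality for \<open>f\<close> minus its linear part at
  \<open>x\<close>: along the segment the gradient of this difference has norm at most
  \<open>L * norm (y - x)\<close>. Using this maximum instead of integrating gives the constant
  \<open>L\<close> in place of \<open>L / 2\<close>.\<close>

lemma taylor_Lipschitz_grad: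
  fixes f :: "real ^ 'n \<Rightarrow> real"
  assumes "\<And>z. z \<in> closed_segment x y \<Longrightarrow> f differentiable (at z)"
    and "\<And>z. z \<in> closed_segment x y \<Longrightarrow> norm (grad f z - grad f x) \<le> L * norm (z - x)"
    and "L \<ge> 0"
  shows "\<bar>f y - f x - grad f x \<bullet> (y - x)\<bar> \<le> L * (norm (y - x))\<^sup>2"
proof -
  let ?g = "\<lambda>z. f z - grad f x \<bullet> z"
  have "norm (?g y - ?g x) \<le> (L * norm (y - x)) * norm (y - x)"
  proof (rule differentiable_bound[where S = "closed_segment x y" and f' = "\<lambda>z v. (grad f z - grad f x) \<bullet> v"])
    fix z assume z: "z \<in> closed_segment x y"
    have "(?g has_derivative (\<lambda>v. grad f z \<bullet> v - grad f x \<bullet> v)) (at z within closed_segment x y)"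
      by (intro derivative_intros has_derivative_at_withinI[OF has_derivative_grad] assms z)
    then show "(?g has_derivative (\<lambda>v. (grad f z - grad f x) \<bullet> v)) (at z within closed_segment x y)"
      by (simp add: inner_diff_left)
    have "norm (grad f z - grad f x) \<le> L * norm (y - x)"
      using assms(2)[OF z] assms(3) segment_bound(1)[OF z] by (meson mult_left_mono order_trans)
    then show "onorm (\<lambda>v. (grad f z - grad f x) \<bullet> v) \<le> L * norm (y - x)"
      by (intro onorm_le) (metis Cauchy_Schwarz_ineq2 mult_right_mono norm_ge_zero order_trans real_norm_def)
  qed auto
  then show ?thesis by (simp add: inner_diff_right power2_eq_square algebra_simps)
qed

section \<open>Recovering a vector from its inner products with the sample directions\<close>

lemma matrix_mul_matrix_inv:
  fixes A :: "real ^ 'n ^ 'm"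
  assumes "invertible A"
  shows "A ** matrix_inv A = mat 1"
  unfolding matrix_inv_def
  by (rule conjunct1[OF someI_ex[OF assms[unfolded invertible_def]]])

text \<open>In the basis of the directions \<open>d j\<close>, \<open>v\<close> has the coefficients
  \<open>w\<close>, and \<open>norm w \<le> B * norm v\<close>. So \<open>v \<bullet> v\<close>,
  being the sum of \<open>w $ j * (v \<bullet> d j)\<close>, is at most
  \<open>CARD('n) * B * norm v * e\<close>, and one factor \<open>norm v\<close> cancels.\<close>

lemma norm_le_if_inner_columns_le:
  fixes d :: "'n::finite \<Rightarrow> real ^ 'n"
  assumes inv: "invertible (column_matrix d)"
    and B: "onorm ((*v) (matrix_inv (column_matrix d))) \<le> B"
    and e: "\<And>j. \<bar>v \<bullet> d j\<bar> \<le> e"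
  shows "norm v \<le> real CARD('n) * B * e"
proof (cases "v = 0")
  case True
  have "0 \<le> B" using B onorm_pos_le[OF matrix_vector_mul_bounded_linear] order_trans by blast
  moreover have "0 \<le> e" using e abs_ge_zero order_trans by blast
  ultimately show ?thesis using True by simp
next
  case False
  define w where "w = matrix_inv (column_matrix d) *v v"
  have e0: "0 \<le> e" using e abs_ge_zero order_trans by blast
  have w: "norm w \<le> B * norm v"
    unfolding w_def using onorm[OF matrix_vector_mul_bounded_linear, of "matrix_inv (column_matrix d)" v] B
    by (meson mult_right_mono norm_ge_zero order_trans)
  have "column_matrix d *v w = v"
    unfolding w_def by (simp add: matrix_vector_mul_assoc matrix_mul_matrix_inv[OF inv])
  moreover have "column_matrix d *v w = (\<Sum>j\<in>UNIV. w $ j *\<^sub>R d j)"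
    by (simp add: vec_eq_iff matrix_vector_mult_def column_matrix_def mult.commute)
  ultimately have v: "v = (\<Sum>j\<in>UNIV. w $ j *\<^sub>R d j)" by simp
  have "norm v * norm v = v \<bullet> v"
    by (simp add: dot_square_norm power2_eq_square)
  also have "\<dots> = v \<bullet> (\<Sum>j\<in>UNIV. w $ j *\<^sub>R d j)"
    using v by (rule arg_cong)
  also have "\<dots> = (\<Sum>j\<in>UNIV. w $ j * (v \<bullet> d j))"
    by (simp add: inner_sum_right)
  also have "\<dots> \<le> (\<Sum>j::'n\<in>UNIV. norm w * e)"
  proof (rule sum_mono)
    fix j
    have "w $ j * (v \<bullet> d j) \<le> \<bar>w $ j\<bar> * \<bar>v \<bullet> d j\<bar>"
      by (metis abs_ge_self abs_mult)
    also have "\<dots> \<le> norm w * e"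
      using e[of j] by (intro mult_mono component_le_norm_cart) auto
    finally show "w $ j * (v \<bullet> d j) \<le> norm w * e" .
  qed
  also have "\<dots> \<le> real CARD('n) * (B * norm v * e)"
    using mult_right_mono[OF w e0] by simp
  finally show ?thesis using False by (simp add: algebra_simps)
qed

section \<open>Derivatives of vector-valued maps, compositions and the quadratic model\<close>

lemma differentiable_vec:
  fixes F :: "'a::real_normed_vector \<Rightarrow> real ^ 'p"
  assumes "\<And>i. (\<lambda>y. F y $ i) differentiable (at x)"
  shows "F differentiable (at x)"
  using assms by (subst differentiable_componentwise_within) (auto simp: Basis_vec_def inner_axis)

lemma vgrad_mult:
  fixes G :: "real ^ 'n \<Rightarrow> real ^ 'p"
  assumes "\<And>i. (\<lambda>y. G y $ i) differentiable (at x)"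
  shows "vgrad G x *v u = (\<Sum>i\<in>UNIV. u $ i *\<^sub>R grad (\<lambda>y. G y $ i) x)"
proof -
  have D: "(G has_derivative frechet_derivative G (at x)) (at x)"
    using differentiable_vec[OF assms] by (simp add: frechet_derivative_works)
  have c: "frechet_derivative (\<lambda>y. G y $ i) (at x) = (\<lambda>v. frechet_derivative G (at x) v $ i)" for i
    using frechet_derivative_at[OF bounded_linear.has_derivative[OF bounded_linear_vec_nth D]] by simp
  have "jacobian G (at x) $ i $ j = grad (\<lambda>y. G y $ i) x $ j" for i j
    by (simp add: jacobian_def matrix_def grad_def c)
  then show ?thesis
    by (simp add: vec_eq_iff vgrad_def transpose_def matrix_vector_mult_def mult.commute)
qed

lemma grad_compose:
  fixes F :: "real ^ 'n \<Rightarrow> real ^ 'p"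
  assumes "\<And>i. (\<lambda>y. F y $ i) differentiable (at x)" "h differentiable (at (F x))"
  shows "grad (\<lambda>y. h (F y)) x = (\<Sum>i\<in>UNIV. grad h (F x) $ i *\<^sub>R grad (\<lambda>y. F y $ i) x)"
proof (rule grad_eqI)
  have D: "(F has_derivative (\<lambda>v. \<chi> i. grad (\<lambda>y. F y $ i) x \<bullet> v)) (at x)"
    using has_derivative_grad[OF assms(1)]
    by (subst has_derivative_componentwise_within) (auto simp: Basis_vec_def inner_axis)
  show "((\<lambda>y. h (F y)) has_derivative
      (\<lambda>v. (\<Sum>i\<in>UNIV. grad h (F x) $ i *\<^sub>R grad (\<lambda>y. F y $ i) x) \<bullet> v)) (at x)"
    using has_derivative_compose[OF D has_derivative_grad[OF assms(2)]]
    by (simp add: inner_sum_left inner_vec_def[of "grad h _"])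
qed

lemma inner_transpose_mult: "(transpose A *v u) \<bullet> v = u \<bullet> ((A :: real ^ 'n ^ 'm) *v v)"
  by (simp add: dot_lmul_matrix)

lemma has_derivative_matrix_vector_mult_diff:
  "((\<lambda>x. (A :: real ^ 'n ^ 'm) *v (x - z)) has_derivative (\<lambda>v. A *v v)) F"
  by (rule bounded_linear.has_derivative[OF matrix_vector_mul_bounded_linear]) (auto intro!: derivative_eq_intros)

text \<open>At \<open>x = xk\<close> only the first term remains. By \<open>vgrad_mult\<close> it
  has the same chain-rule form that \<open>grad_compose\<close> gives for the objective, so the two
  gradients can be compared term by term.\<close>

lemma grad_quad_model:
  "grad (quad_model h Q xk) x =
     vgrad Q xk *v grad h (Q xk)
     + (1 / 2) *\<^sub>R ((model_hess h Q xk + transpose (model_hess h Q xk)) *v (x - xk))"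
proof (rule grad_eqI)
  let ?H = "model_hess h Q xk" and ?V = "vgrad Q xk"
  have "(quad_model h Q xk has_derivative (\<lambda>v. grad h (Q xk) \<bullet> (transpose ?V *v v)
     + 1 / 2 * ((x - xk) \<bullet> (?H *v v) + v \<bullet> (?H *v (x - xk))))) (at x)"
    unfolding quad_model_def
    by (auto intro!: derivative_eq_intros has_derivative_matrix_vector_mult_diff simp del: transpose_matrix_vector)
  moreover have "grad h (Q xk) \<bullet> (transpose ?V *v v)
     + 1 / 2 * ((x - xk) \<bullet> (?H *v v) + v \<bullet> (?H *v (x - xk)))
     = (?V *v grad h (Q xk) + (1 / 2) *\<^sub>R ((?H + transpose ?H) *v (x - xk))) \<bullet> v" for v
    using inner_transpose_mult[of "transpose ?V" "grad h (Q xk)" v] inner_transpose_mult[of ?H "x - xk" v]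
    by (simp add: inner_add_left inner_add_right matrix_vector_mult_add_rdistrib inner_commute del: transpose_matrix_vector)
  ultimately show "(quad_model h Q xk has_derivative (\<lambda>v. (?V *v grad h (Q xk)
     + (1 / 2) *\<^sub>R ((?H + transpose ?H) *v (x - xk))) \<bullet> v)) (at x)"
    by simp
qed

text \<open>The matrix of the model need not be symmetric a priori, but only its symmetric part, which is
  the Hessian of the model, enters the quadratic form.\<close>

lemma quad_model_expansion:
  "quad_model h Q xk (xk + v) - quad_model h Q xk xk =
     grad (quad_model h Q xk) xk \<bullet> v + 1 / 2 * (v \<bullet> (hess (quad_model h Q xk) xk *v v))"
proof -
  let ?H = "model_hess h Q xk" and ?V = "vgrad Q xk"
  define S where "S = (1 / 2) *\<^sub>R (?H + transpose ?H)"
  have g: "grad (quad_model h Q xk) = (\<lambda>x. ?V *v grad h (Q xk) + S *v (x - xk))"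
    by (simp add: fun_eq_iff grad_quad_model S_def scaleR_matrix_vector_assoc)
  have "((\<lambda>x. ?V *v grad h (Q xk) + S *v (x - xk)) has_derivative (\<lambda>v. S *v v)) (at xk)"
    by (auto intro!: derivative_eq_intros has_derivative_matrix_vector_mult_diff)
  then have "hess (quad_model h Q xk) xk = matrix ((*v) S)"
    unfolding hess_def g jacobian_def by (simp add: frechet_derivative_at[symmetric])
  then have "hess (quad_model h Q xk) xk = S" by simp
  moreover have "v \<bullet> (S *v v) = v \<bullet> (?H *v v)"
    using inner_transpose_mult[of ?H v v]
    by (simp add: S_def inner_add_right matrix_vector_mult_add_rdistrib inner_commute
        scaleR_matrix_vector_assoc[symmetric] del: transpose_matrix_vector)
  moreover have "grad h (Q xk) \<bullet> (transpose ?V *v v) = (?V *v grad h (Q xk)) \<bullet> v"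
    using inner_transpose_mult[of "transpose ?V" "grad h (Q xk)" v]
    by (simp del: transpose_matrix_vector)
  ultimately show ?thesis by (simp add: g quad_model_def)
qed

section \<open>The criticality measure and its dependence on gradient and base point\<close>

lemma crit_measure_ge:
  fixes g :: "real ^ 'n"
  assumes "tr \<ge> 1" "x \<in> S" "x + d \<in> S" "tr_norm tr d \<le> 1"
  shows "- (g \<bullet> d) \<le> crit_measure tr S g x"
proof -
  let ?A = "{d. x + d \<in> S \<and> tr_norm tr d \<le> 1}"
  have "bdd_below ((\<lambda>d. g \<bullet> d) ` ?A)"
  proof (rule bdd_belowI2)
    fix d assume "d \<in> ?A"
    then have "(- g) \<bullet> d \<le> norm (- g) * real CARD('n)"
      using inner_le_tr_dual_norm_bound[OF assms(1)] by blast
    then show "- (norm g * real CARD('n)) \<le> g \<bullet> d" by simp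
  qed
  then have "(INF d\<in>?A. g \<bullet> d) \<le> g \<bullet> d"
    using assms by (intro cINF_lower) auto
  then show ?thesis unfolding crit_measure_def by linarith
qed

text \<open>The zero step is feasible, so the infimum is at most 0 and the absolute value in
  \<open>crit_measure\<close> is its negation. With \<open>crit_measure_ge\<close>, the measure
  becomes the supremum of \<open>- (g \<bullet> d)\<close> over feasible steps.\<close>

lemma crit_measure_le:
  assumes "tr \<ge> 1" "x \<in> S"
    and "\<And>d. x + d \<in> S \<Longrightarrow> tr_norm tr d \<le> 1 \<Longrightarrow> - (g \<bullet> d) \<le> B"
  shows "crit_measure tr S g x \<le> B"
proof -
  let ?A = "{d. x + d \<in> S \<and> tr_norm tr d \<le> 1}"
  have 0: "0 \<in> ?A" using assms by (simp add: tr_norm_zero)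
  have lb: "- B \<le> g \<bullet> d" if "d \<in> ?A" for d
    using assms(3)[of d] that by simp
  then have "- B \<le> (INF d\<in>?A. g \<bullet> d)"
    using 0 by (intro cINF_greatest) blast+
  moreover have "(INF d\<in>?A. g \<bullet> d) \<le> g \<bullet> 0"
    using 0 lb by (intro cINF_lower bdd_belowI2[where m = "- B"]) blast+
  ultimately show ?thesis unfolding crit_measure_def by simp
qed

text \<open>A step that is feasible at \<open>x\<close> becomes feasible at \<open>y\<close> when each component is shrunk
  towards \<open>0\<close> by at most the corresponding component of \<open>x - y\<close>.\<close>

lemma bound_box_transfer_step:
  assumes "tr \<ge> 1" "x \<in> bound_box xL xU" "y \<in> bound_box xL xU"
    and "x + d \<in> bound_box xL xU" "tr_norm tr d \<le> 1"
  obtains d' where "y + d' \<in> bound_box xL xU" "tr_norm tr d' \<le> 1" "norm (d - d') \<le> norm (x - y)"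
proof
  define c where "c t r = sgn t * max 0 (\<bar>t\<bar> - \<bar>r\<bar>)" for t r :: real
  have c1: "\<bar>c t r\<bar> \<le> \<bar>t\<bar>" "\<bar>t - c t r\<bar> \<le> \<bar>r\<bar>" for t r
    by (auto simp: c_def sgn_if abs_mult max_def)
  define d' where "d' = (\<chi> j. c (d $ j) ((x - y) $ j))"
  have d': "d' $ j = c (d $ j) (x $ j - y $ j)" for j by (simp add: d'_def)
  \<comment> \<open>A component of \<open>d'\<close> is 0 or keeps the sign of \<open>d $ j\<close>;
    giving up \<open>\<bar>x $ j - y $ j\<bar>\<close> of its length compensates for the moved base
    point, so the result lies between two feasible values.\<close>
  have lo: "min (y $ j) (x $ j + d $ j) \<le> (y + d') $ j"
    and hi: "(y + d') $ j \<le> max (y $ j) (x $ j + d $ j)" for j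
    by (auto simp: d' c_def sgn_if max_def min_def)
  show "y + d' \<in> bound_box xL xU"
    unfolding bound_box_def mem_Collect_eq
  proof (intro allI conjI)
    fix j
    have "xL j \<le> ereal (min (y $ j) (x $ j + d $ j))" "ereal (max (y $ j) (x $ j + d $ j)) \<le> xU j"
      using assms(3,4) by (auto simp: bound_box_def min_def max_def)
    then show "xL j \<le> ereal ((y + d') $ j)" "ereal ((y + d') $ j) \<le> xU j"
      using lo[of j] hi[of j] by (meson ereal_less_eq(3) order_trans)+
  qed
  show "tr_norm tr d' \<le> 1"
    using tr_norm_mono[OF assms(1), of d' d] c1(1) assms(5) by (force simp: d')
  show "norm (d - d') \<le> norm (x - y)"
    by (rule norm_le_componentwise_cart) (simp add: d' c1(2))
qed

text \<open>A feasible step at \<open>x\<close> is compared with its transferred step at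
  \<open>y\<close>: changing the gradient costs the first error term, as steps lie in the unit ball,
  and changing the step costs the second.\<close>

lemma crit_measure_Lipschitz:
  fixes g g' :: "real ^ 'n"
  assumes "tr \<ge> 1" "x \<in> bound_box xL xU" "y \<in> bound_box xL xU"
  shows "crit_measure tr (bound_box xL xU) g x
    \<le> crit_measure tr (bound_box xL xU) g' y + real CARD('n) * norm (g - g') + norm g' * norm (x - y)"
proof (rule crit_measure_le[OF assms(1,2)])
  fix d assume d: "x + d \<in> bound_box xL xU" "tr_norm tr d \<le> 1"
  obtain d' where d': "y + d' \<in> bound_box xL xU" "tr_norm tr d' \<le> 1" "norm (d - d') \<le> norm (x - y)"
    using bound_box_transfer_step[OF assms d] .
  have "(g' - g) \<bullet> d \<le> norm (g - g') * real CARD('n)"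
    using inner_le_tr_dual_norm_bound[OF assms(1) d(2), of "g' - g"] by (simp add: norm_minus_commute)
  moreover have "g' \<bullet> (d' - d) \<le> norm g' * norm (x - y)"
    using norm_cauchy_schwarz[of g' "d' - d"] d'(3)
    by (smt (verit) mult_left_mono norm_ge_zero norm_minus_commute)
  moreover have "- (g' \<bullet> d') \<le> crit_measure tr (bound_box xL xU) g' y"
    using crit_measure_ge[OF assms(1,3) d'(1,2)] .
  ultimately show "- (g \<bullet> d) \<le> crit_measure tr (bound_box xL xU) g' y
      + real CARD('n) * norm (g - g') + norm g' * norm (x - y)"
    by (simp add: inner_diff_left inner_diff_right algebra_simps)
qed

section \<open>Convergence of radii and criticality as statements about real sequences\<close>

lemma decseq_bdd_below_limit:
  fixes \<phi> :: "nat \<Rightarrow> real"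
  assumes "decseq \<phi>" "bdd_below (range \<phi>)"
  obtains l where "\<phi> \<longlonglongrightarrow> l" "\<And>k. l \<le> \<phi> k"
proof -
  obtain B where "\<And>k. B \<le> \<phi> k" using assms(2) by (auto simp: bdd_below_def)
  then show ?thesis using decseq_convergent[OF assms(1), of B] that by blast
qed

text \<open>Late successes occur only at radii below \<open>\<epsilon>\<close>, because the drops of
  the convergent \<open>\<phi>\<close> fall below \<open>w \<epsilon>\<close>. Without successes the
  radius decays geometrically, so it does get below \<open>r\<close>; from then on a success starts
  below \<open>\<epsilon>\<close>, and every other step shrinks the radius.\<close>

lemma trust_region_radius_tendsto_0:
  fixes \<Delta> \<phi> :: "nat \<Rightarrow> real" and w :: "real \<Rightarrow> real"
  assumes pos: "\<And>k. \<Delta> k > 0" and \<gamma>: "0 < \<gamma>dec" "\<gamma>dec < 1" "1 < \<gamma>inc"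
    and bdd: "bdd_below (range \<phi>)"
    and w: "mono w" "\<And>t. t > 0 \<Longrightarrow> w t > 0"
    and fail: "\<And>k. k \<notin> S \<Longrightarrow> \<Delta> (Suc k) = \<gamma>dec * \<Delta> k \<and> \<phi> (Suc k) = \<phi> k"
    and succ: "\<And>k. k \<in> S \<Longrightarrow> \<Delta> (Suc k) \<le> \<gamma>inc * \<Delta> k \<and> w (\<Delta> k) \<le> \<phi> k - \<phi> (Suc k)"
  shows "\<Delta> \<longlonglongrightarrow> 0"
proof (rule LIMSEQ_I)
  fix r :: real assume "r > 0"
  \<comment> \<open>One expansion by \<open>\<gamma>inc\<close> from below \<open>\<epsilon>\<close>
    stays below \<open>r\<close>.\<close>
  define \<epsilon> where "\<epsilon> = r / \<gamma>inc"
  have \<epsilon>: "\<epsilon> > 0" "r = \<gamma>inc * \<epsilon>" using \<open>r > 0\<close> \<gamma> by (auto simp: \<epsilon>_def)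
  have "\<phi> (Suc k) \<le> \<phi> k" for k
    using fail[of k] succ[of k] w(2)[OF pos, of k] by (cases "k \<in> S") auto
  then have "decseq \<phi>" by (rule decseq_SucI)
  then obtain l where "\<phi> \<longlonglongrightarrow> l"
    using bdd decseq_bdd_below_limit by blast
  then have "(\<lambda>k. \<phi> k - \<phi> (Suc k)) \<longlonglongrightarrow> l - l"
    by (intro tendsto_diff LIMSEQ_Suc)
  then have "\<forall>\<^sub>F k in sequentially. \<phi> k - \<phi> (Suc k) < w \<epsilon>"
    using w(2)[OF \<epsilon>(1)] by (intro order_tendstoD(2)) auto
  then obtain K where K: "\<And>k. k \<ge> K \<Longrightarrow> \<phi> k - \<phi> (Suc k) < w \<epsilon>"
    by (auto simp: eventually_sequentially)
  have small: "\<Delta> k < \<epsilon>" if "k \<ge> K" "k \<in> S" for k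
    using K[OF that(1)] succ[OF that(2)] monoD[OF w(1), of \<epsilon> "\<Delta> k"] by force
  have "\<exists>k\<ge>K. \<Delta> k < r"
  proof (rule ccontr)
    assume neg: "\<not> (\<exists>k\<ge>K. \<Delta> k < r)"
    have "\<epsilon> < r" using \<epsilon> \<gamma> by simp
    then have "k \<notin> S" if "k \<ge> K" for k using small neg that by force
    then have "\<Delta> (K + i) = \<gamma>dec ^ i * \<Delta> K" for i
      using fail by (induction i) auto
    moreover have "(\<lambda>i. \<gamma>dec ^ i * \<Delta> K) \<longlonglongrightarrow> 0 * \<Delta> K"
      using \<gamma> by (intro tendsto_mult_right LIMSEQ_realpow_zero) auto
    ultimately have "\<forall>\<^sub>F i in sequentially. \<Delta> (K + i) < r"
      using \<open>r > 0\<close> by (auto dest: order_tendstoD(2))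
    then show False using neg by (auto simp: eventually_sequentially)
  qed
  then obtain k1 where k1: "k1 \<ge> K" "\<Delta> k1 < r" by blast
  have "\<Delta> k < r" if "k \<ge> k1" for k
    using that
  proof (induction k rule: dec_induct)
    case base then show ?case by (rule k1)
  next
    case (step k)
    show ?case
    proof (cases "k \<in> S")
      case True
      then have "\<gamma>inc * \<Delta> k < \<gamma>inc * \<epsilon>" using small k1 step \<gamma> by simp
      then show ?thesis using succ[OF True] \<epsilon> by linarith
    next
      case False
      then have "\<Delta> (Suc k) = \<gamma>dec * \<Delta> k" using fail by blast
      also have "\<dots> < \<Delta> k" using \<gamma> pos by simp
      finally show ?thesis using step by simp
    qed
  qed
  then show "\<exists>no. \<forall>n\<ge>no. norm (\<Delta> n - 0) < r"
    using pos by (auto simp: abs_of_pos)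
qed

text \<open>Start at a late index where \<open>a\<close> is below \<open>e\<close>. Climbing out of
  that range takes one increment, itself below \<open>e\<close>; any further climb is paid for by
  drops of \<open>\<phi>\<close>, whose remaining total times \<open>C\<close> is below
  \<open>e\<close>. Hence \<open>a\<close> stays below \<open>3 * e\<close>.\<close>

lemma tendsto_0_if_increments_controlled:
  fixes a \<phi> :: "nat \<Rightarrow> real"
  assumes nonneg: "\<And>k. a k \<ge> 0"
    and \<phi>: "decseq \<phi>" "bdd_below (range \<phi>)"
    and inf: "\<And>e K. e > 0 \<Longrightarrow> \<exists>k\<ge>K. a k < e"
    and inc: "(\<lambda>k. a (Suc k) - a k) \<longlonglongrightarrow> 0"
    and ctrl: "\<And>e. e > 0 \<Longrightarrow> \<exists>C\<ge>0. \<exists>K. \<forall>k\<ge>K. a k \<ge> e \<longrightarrow> a (Suc k) - a k \<le> C * (\<phi> k - \<phi> (Suc k))"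
  shows "a \<longlonglongrightarrow> 0"
proof (rule LIMSEQ_I)
  fix r :: real assume "r > 0"
  define e where "e = r / 3"
  have e: "e > 0" "r = 3 * e" using \<open>r > 0\<close> by (auto simp: e_def)
  obtain C K where C: "C \<ge> 0" "\<And>k. k \<ge> K \<Longrightarrow> a k \<ge> e \<Longrightarrow> a (Suc k) - a k \<le> C * (\<phi> k - \<phi> (Suc k))"
    using ctrl[OF e(1)] by blast
  obtain l where l: "\<phi> \<longlonglongrightarrow> l" "\<And>k. l \<le> \<phi> k"
    using \<phi> decseq_bdd_below_limit by blast
  have "(\<lambda>k. C * (\<phi> k - l)) \<longlonglongrightarrow> C * (l - l)"
    by (intro tendsto_intros l)
  then have "\<forall>\<^sub>F k in sequentially. C * (\<phi> k - l) < e"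
    using e by (intro order_tendstoD(2)) auto
  moreover have "\<forall>\<^sub>F k in sequentially. a (Suc k) - a k < e"
    using inc e by (intro order_tendstoD(2)) auto
  ultimately have "\<forall>\<^sub>F k in sequentially. k \<ge> K \<and> C * (\<phi> k - l) < e \<and> a (Suc k) - a k < e"
    by (intro eventually_conj eventually_ge_at_top)
  then obtain K' where K': "\<And>k. k \<ge> K' \<Longrightarrow> k \<ge> K \<and> C * (\<phi> k - l) < e \<and> a (Suc k) - a k < e"
    by (auto simp: eventually_sequentially)
  obtain k1 where k1: "k1 \<ge> K'" "a k1 < e" using inf[OF e(1)] by blast
  have mono: "C * (\<phi> k1 - \<phi> k) \<ge> 0" if "k \<ge> k1" for k
    using C(1) decseqD[OF \<phi>(1) that] by simp
  \<comment> \<open>The drops are counted from \<open>k1\<close> and not from the latest return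
    below \<open>e\<close>, so the induction need not keep track of excursions.\<close>
  have "a k \<le> 2 * e + C * (\<phi> k1 - \<phi> k)" if "k \<ge> k1" for k
    using that
  proof (induction k rule: dec_induct)
    case base then show ?case using k1 e by simp
  next
    case (step k)
    show ?case
    proof (cases "a k < e")
      case True
      then show ?thesis using K'[of k] k1 step mono[of "Suc k"] by linarith
    next
      case False
      then have "a (Suc k) - a k \<le> C * (\<phi> k - \<phi> (Suc k))" using C(2) K'[of k] k1 step by simp
      then show ?thesis using step by (simp add: algebra_simps)
    qed
  qed
  moreover have "C * (\<phi> k1 - \<phi> k) < e" for k
    using K'[OF k1(1)] C(1) l(2)[of k] by (smt (verit) mult_left_mono)
  ultimately have "a k < r" if "k \<ge> k1" for k
    using that e(2) by (smt (verit))
  then show "\<exists>no. \<forall>n\<ge>no. norm (a n - 0) < r"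
    using nonneg by auto
qed

text \<open>The algorithm reduced to real sequences: \<open>a\<close> is the true criticality,
  \<open>\<pi>\<close> that of the models, \<open>\<phi>\<close> the objective values and
  \<open>S\<close> the set of successful iterations. The radius limit comes first and then feeds the
  hypotheses on small and controlled increments of \<open>a\<close>.\<close>

lemma trust_region_criticality_tendsto_0:
  fixes a \<pi> \<Delta> \<phi> :: "nat \<Rightarrow> real"
  assumes nonneg: "\<And>k. a k \<ge> 0" "\<And>k. \<pi> k \<ge> 0"
    and pos: "\<And>k. \<Delta> k > 0" and \<gamma>: "0 < \<gamma>dec" "\<gamma>dec < 1" "1 < \<gamma>inc"
    and par: "0 < \<mu>" "0 < \<epsilon>c" "0 < \<beta>" "0 < c"
    and bdd: "bdd_below (range \<phi>)"
    and approx: "\<And>k. \<bar>a k - \<pi> k\<bar> \<le> E * \<Delta> k"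
    and lip: "\<And>k. \<bar>a (Suc k) - a k\<bar> \<le> L * \<Delta> k" "0 \<le> L"
    and fail: "\<And>k. k \<notin> S \<Longrightarrow> \<Delta> (Suc k) = \<gamma>dec * \<Delta> k \<and> \<phi> (Suc k) = \<phi> k"
    and radius: "\<And>k. k \<in> S \<Longrightarrow> \<Delta> k \<le> \<Delta> (Suc k) \<and> \<Delta> (Suc k) \<le> \<gamma>inc * \<Delta> k"
    and noncrit: "\<And>k. k \<in> S \<Longrightarrow> \<pi> k > \<epsilon>c \<or> \<Delta> k \<le> \<mu> * \<pi> k"
    and decr: "\<And>k. k \<in> S \<Longrightarrow> c * \<pi> k * min (\<pi> k / \<beta>) (min (\<Delta> k) 1) \<le> \<phi> k - \<phi> (Suc k)"
    and small: "\<And>e. e > 0 \<Longrightarrow> \<exists>t>0. \<forall>k. \<pi> k \<ge> e \<longrightarrow> \<Delta> k \<le> t \<longrightarrow> k \<in> S"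
  shows "a \<longlonglongrightarrow> 0"
proof -
  \<comment> \<open>The decrease in \<open>decr\<close> with \<open>\<pi> k\<close> replaced by its
    lower bound \<open>min \<epsilon>c (\<Delta> k / \<mu>)\<close> from \<open>noncrit\<close>. For
    negative \<open>t\<close> the product of two negative factors would be positive; the value 0
    there keeps \<open>w\<close> monotone.\<close>
  define w where "w t = (if t \<le> 0 then 0 else
    c * min \<epsilon>c (t / \<mu>) * min (min \<epsilon>c (t / \<mu>) / \<beta>) (min t 1))" for t
  have w_mono: "mono w"
  proof (rule monoI)
    fix s t :: real assume st: "s \<le> t"
    show "w s \<le> w t"
    proof (cases "s \<le> 0")
      case True then show ?thesis using par by (simp add: w_def)
    next
      case False
      have "s / \<mu> \<le> t / \<mu>" using st par by (simp add: divide_right_mono)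
      then have m: "min \<epsilon>c (s / \<mu>) \<le> min \<epsilon>c (t / \<mu>)" by simp
      then have "min \<epsilon>c (s / \<mu>) / \<beta> \<le> min \<epsilon>c (t / \<mu>) / \<beta>" using par by (simp add: divide_right_mono)
      then have "min (min \<epsilon>c (s / \<mu>) / \<beta>) (min s 1) \<le> min (min \<epsilon>c (t / \<mu>) / \<beta>) (min t 1)"
        using st by (intro min.mono) auto
      then have "c * min \<epsilon>c (s / \<mu>) * min (min \<epsilon>c (s / \<mu>) / \<beta>) (min s 1)
        \<le> c * min \<epsilon>c (t / \<mu>) * min (min \<epsilon>c (t / \<mu>) / \<beta>) (min t 1)"
        using m par False st by (intro mult_mono) auto
      then show ?thesis using False st by (simp add: w_def)
    qed
  qed
  have w_pos: "w t > 0" if "t > 0" for t using that par by (simp add: w_def)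
  have w_le: "w (\<Delta> k) \<le> \<phi> k - \<phi> (Suc k)" if "k \<in> S" for k
  proof -
    have m: "min \<epsilon>c (\<Delta> k / \<mu>) \<le> \<pi> k" 
      using noncrit[OF that]
    proof
      assume "\<Delta> k \<le> \<mu> * \<pi> k"
      then have "\<Delta> k / \<mu> \<le> \<pi> k" using par by (simp add: pos_divide_le_eq mult.commute)
      then show ?thesis by simp
    qed simp
    then have "min (min \<epsilon>c (\<Delta> k / \<mu>) / \<beta>) (min (\<Delta> k) 1) \<le> min (\<pi> k / \<beta>) (min (\<Delta> k) 1)"
      using divide_right_mono[OF m, of \<beta>] par by (intro min.mono) auto
    then have "w (\<Delta> k) \<le> c * \<pi> k * min (\<pi> k / \<beta>) (min (\<Delta> k) 1)"
      unfolding w_def using m pos[of k] par nonneg by (auto intro!: mult_mono simp: less_imp_le)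
    then show ?thesis using decr[OF that] by simp
  qed
  have \<Delta>0: "\<Delta> \<longlonglongrightarrow> 0"
    by (rule trust_region_radius_tendsto_0[OF pos \<gamma> bdd w_mono w_pos fail, of S]) (use radius w_le in auto)
  have "\<phi> (Suc k) \<le> \<phi> k" for k
    using fail[of k] w_le[of k] w_pos[OF pos, of k] by (cases "k \<in> S") auto
  then have dec: "decseq \<phi>" by (rule decseq_SucI)
  have E0: "(\<lambda>k. E * \<Delta> k) \<longlonglongrightarrow> 0" using tendsto_mult_left[OF \<Delta>0, of E] by simp
  show ?thesis
  proof (rule tendsto_0_if_increments_controlled[OF nonneg(1) dec bdd])
    show "(\<lambda>k. a (Suc k) - a k) \<longlonglongrightarrow> 0"
      by (rule Lim_null_comparison[where g = "\<lambda>k. L * \<Delta> k"])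
        (use lip tendsto_mult_left[OF \<Delta>0, of L] in \<open>auto simp: always_eventually\<close>)
  next
    fix e :: real and K assume e: "e > 0"
    obtain t where t: "t > 0" "\<And>k. \<pi> k \<ge> e / 2 \<Longrightarrow> \<Delta> k \<le> t \<Longrightarrow> k \<in> S"
      using small[of "e / 2"] e by auto
    have "\<forall>\<^sub>F k in sequentially. \<Delta> k < t \<and> E * \<Delta> k < e / 2"
      using order_tendstoD(2)[OF \<Delta>0 t(1)] order_tendstoD(2)[OF E0, of "e / 2"] e by (auto intro: eventually_conj)
    then obtain N where N: "\<And>k. k \<ge> N \<Longrightarrow> \<Delta> k < t \<and> E * \<Delta> k < e / 2"
      by (auto simp: eventually_sequentially)
    show "\<exists>k\<ge>K. a k < e"
    proof (rule ccontr)
      assume neg: "\<not> (\<exists>k\<ge>K. a k < e)"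
      define M where "M = max K N"
      \<comment> \<open>If \<open>a\<close> stayed above \<open>e\<close>, then \<open>\<pi>\<close>
        would stay above \<open>e / 2\<close> and all late steps would succeed; the radius would
        never shrink again, although it tends to 0.\<close>
      have "k \<in> S" if "k \<ge> M" for k
        using t(2)[of k] N[of k] neg approx[of k] that by (force simp: M_def)
      then have "\<Delta> M \<le> \<Delta> (M + i)" for i
        using radius by (induction i) (auto intro: order_trans)
      then have "\<Delta> M \<le> 0"
        using LIMSEQ_le_const[OF LIMSEQ_ignore_initial_segment[OF \<Delta>0, of M]] by (simp add: add.commute)
      then show False using pos[of M] by simp
    qed
  next
    fix e :: real assume e: "e > 0"
    obtain t where t: "t > 0" "\<And>k. \<pi> k \<ge> e / 2 \<Longrightarrow> \<Delta> k \<le> t \<Longrightarrow> k \<in> S"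
      using small[of "e / 2"] e by auto
    \<comment> \<open>Below \<open>r\<close> the radius itself is the active term of the minimum in
      \<open>decr\<close>.\<close>
    define r where "r = min 1 (e / 2 / \<beta>)"
    have r: "r > 0" using e par by (simp add: r_def)
    have "\<forall>\<^sub>F k in sequentially. \<Delta> k < t \<and> E * \<Delta> k < e / 2 \<and> \<Delta> k < r"
      using order_tendstoD(2)[OF \<Delta>0 t(1)] order_tendstoD(2)[OF E0, of "e / 2"] order_tendstoD(2)[OF \<Delta>0 r] e
      by (auto intro: eventually_conj)
    then obtain N where N: "\<And>k. k \<ge> N \<Longrightarrow> \<Delta> k < t \<and> E * \<Delta> k < e / 2 \<and> \<Delta> k < r"
      by (auto simp: eventually_sequentially)
    \<comment> \<open>The possible increase \<open>L * \<Delta> k\<close> of \<open>a\<close>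
      divided by the guaranteed drop \<open>c * (e / 2) * \<Delta> k\<close> of
      \<open>\<phi>\<close>.\<close>
    define C where "C = L / (c * (e / 2))"
    have "a (Suc k) - a k \<le> C * (\<phi> k - \<phi> (Suc k))" if k: "k \<ge> N" "a k \<ge> e" for k
    proof -
      have \<pi>: "\<pi> k \<ge> e / 2" using N[OF k(1)] approx[of k] k(2) by linarith
      then have S: "k \<in> S" using t(2) N[OF k(1)] by simp
      have "e / 2 / \<beta> \<le> \<pi> k / \<beta>" using \<pi> par by (intro divide_right_mono) auto
      then have "min (\<pi> k / \<beta>) (min (\<Delta> k) 1) = \<Delta> k"
        using N[OF k(1)] unfolding r_def by linarith
      then have "c * (e / 2) * \<Delta> k \<le> \<phi> k - \<phi> (Suc k)"
        using decr[OF S] \<pi> par pos[of k] by (smt (verit) mult_left_mono mult_right_mono)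
      then have "C * (c * (e / 2) * \<Delta> k) \<le> C * (\<phi> k - \<phi> (Suc k))"
        using lip(2) par e by (intro mult_left_mono) (auto simp: C_def)
      moreover have "C * (c * (e / 2) * \<Delta> k) = L * \<Delta> k" using par e by (simp add: C_def)
      ultimately show ?thesis using lip(1)[of k] by linarith
    qed
    moreover have "C \<ge> 0" using lip(2) par e by (simp add: C_def)
    ultimately show "\<exists>C\<ge>0. \<exists>K. \<forall>k\<ge>K. e \<le> a k \<longrightarrow> a (Suc k) - a k \<le> C * (\<phi> k - \<phi> (Suc k))"
      by blast
  qed
qed

section \<open>Segments in the feasible region and error estimates\<close>

lemma convex_bound_box:
  fixes xL xU :: "'n::finite \<Rightarrow> ereal"
  shows "convex (bound_box xL xU)"
proof (rule convexI)
  fix x y :: "real ^ 'n" and u v :: real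
  assume x: "x \<in> bound_box xL xU" and y: "y \<in> bound_box xL xU" and uv: "0 \<le> u" "0 \<le> v" "u + v = 1"
  show "u *\<^sub>R x + v *\<^sub>R y \<in> bound_box xL xU"
    unfolding bound_box_def mem_Collect_eq
  proof (intro allI conjI)
    fix j
    have "u * x $ j + v * y $ j \<le> max (x $ j) (y $ j)"
      using uv by (intro convex_bound_le) auto
    moreover have "u * (- x $ j) + v * (- y $ j) \<le> - min (x $ j) (y $ j)"
      using uv by (intro convex_bound_le) auto
    ultimately have b: "min (x $ j) (y $ j) \<le> (u *\<^sub>R x + v *\<^sub>R y) $ j"
      "(u *\<^sub>R x + v *\<^sub>R y) $ j \<le> max (x $ j) (y $ j)" by auto
    have "xL j \<le> ereal (min (x $ j) (y $ j))" "ereal (max (x $ j) (y $ j)) \<le> xU j"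
      using x y by (auto simp: bound_box_def min_def max_def)
    then show "xL j \<le> ereal ((u *\<^sub>R x + v *\<^sub>R y) $ j)" "ereal ((u *\<^sub>R x + v *\<^sub>R y) $ j) \<le> xU j"
      using b by (meson ereal_less_eq(3) order_trans)+
  qed
qed

text \<open>Keeps whole segments from an iterate to sample and trial points where smoothness is
  assumed, as the mean value arguments require.\<close>

lemma closed_segment_subset_enlarged_level_set:
  assumes "tr \<ge> 1" "f y \<le> f x0" "tr_norm tr d \<le> r"
  shows "closed_segment y (y + d) \<subseteq> enlarged_level_set tr r f x0"
proof
  fix z assume "z \<in> closed_segment y (y + d)"
  then obtain u where u: "0 \<le> u" "u \<le> 1" "z = (1 - u) *\<^sub>R y + u *\<^sub>R (y + d)"
    by (auto simp: in_segment)
  have "tr_norm tr (u *\<^sub>R d) \<le> 1 * tr_norm tr d"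
    unfolding tr_norm_scaleR[OF assms(1)] using u by (intro mult_right_mono tr_norm_nonneg) auto
  then have "tr_norm tr (u *\<^sub>R d) \<le> r" using assms(3) by simp
  moreover have "z = y + u *\<^sub>R d" using u(3) by (simp add: algebra_simps)
  ultimately show "z \<in> enlarged_level_set tr r f x0"
    unfolding enlarged_level_set_def using assms(2) by blast
qed

lemma norm_vec_le_sum:
  fixes x :: "real ^ 'n"
  assumes "\<And>i. \<bar>x $ i\<bar> \<le> b i"
  shows "norm x \<le> sum b UNIV"
  using norm_le_l1_cart[of x] sum_mono[of UNIV "\<lambda>i. \<bar>x $ i\<bar>" b] assms by simp

text \<open>Splits each term as \<open>(\<alpha> i - \<beta> i) *\<^sub>R v i + \<alpha> i *\<^sub>R
  (u i - v i)\<close>. It serves to compare two chain-rule gradients.\<close>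

lemma norm_sum_scaleR_diff_le:
  fixes u v :: "'i \<Rightarrow> 'a::real_normed_vector"
  assumes "\<And>i. \<bar>\<alpha> i - \<beta> i\<bar> \<le> a i" "\<And>i. norm (v i) \<le> b i" "\<And>i. \<bar>\<alpha> i\<bar> \<le> c i"
    "\<And>i. norm (u i - v i) \<le> d i"
  shows "norm ((\<Sum>i\<in>I. \<alpha> i *\<^sub>R u i) - (\<Sum>i\<in>I. \<beta> i *\<^sub>R v i)) \<le> (\<Sum>i\<in>I. a i * b i + c i * d i)"
proof -
  have "norm (\<Sum>i\<in>I. \<alpha> i *\<^sub>R u i - \<beta> i *\<^sub>R v i) \<le> (\<Sum>i\<in>I. a i * b i + c i * d i)"
  proof (rule sum_norm_le)
    fix i
    have "\<alpha> i *\<^sub>R u i - \<beta> i *\<^sub>R v i = (\<alpha> i - \<beta> i) *\<^sub>R v i + \<alpha> i *\<^sub>R (u i - v i)"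
      by (simp add: algebra_simps)
    also have "norm \<dots> \<le> \<bar>\<alpha> i - \<beta> i\<bar> * norm (v i) + \<bar>\<alpha> i\<bar> * norm (u i - v i)"
      by (metis norm_scaleR norm_triangle_ineq)
    also have "\<dots> \<le> a i * b i + c i * d i"
      by (intro add_mono mult_mono assms order_trans[OF abs_ge_zero assms(1)]
          order_trans[OF abs_ge_zero assms(3)]) auto
    finally show "norm (\<alpha> i *\<^sub>R u i - \<beta> i *\<^sub>R v i) \<le> a i * b i + c i * d i" .
  qed
  then show ?thesis by (simp add: sum_subtractf)
qed

text \<open>Since \<open>u\<close> and \<open>v\<close> agree up to \<open>a * r\<^sup>2\<close> at
  \<open>x\<close> and at \<open>x + d j\<close>, Taylor expansion of both makes the gradient
  difference along \<open>d j\<close> of order \<open>r\<^sup>2\<close>. Inverting the direction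
  matrix costs a factor \<open>\<Lambda> / r\<close>, which leaves order \<open>r\<close>.\<close>

lemma interpolation_gradient_error:
  fixes u v :: "real ^ 'n \<Rightarrow> real" and d :: "'n \<Rightarrow> real ^ 'n"
  assumes tr: "tr \<ge> 1" and r: "r > 0"
    and inv: "invertible (column_matrix d)"
      "onorm ((*v) (matrix_inv (column_matrix d))) \<le> \<Lambda> / r"
    and d: "\<And>j. tr_norm tr (d j) \<le> r"
    and diff: "\<And>j z. z \<in> closed_segment x (x + d j) \<Longrightarrow> u differentiable (at z) \<and> v differentiable (at z)"
    and lip: "\<And>j z. z \<in> closed_segment x (x + d j) \<Longrightarrow> norm (grad u z - grad u x) \<le> Lu * norm (z - x)"
      "\<And>j z. z \<in> closed_segment x (x + d j) \<Longrightarrow> norm (grad v z - grad v x) \<le> Lv * norm (z - x)"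
    and L: "Lu \<ge> 0" "Lv \<ge> 0"
    and a: "\<bar>u x - v x\<bar> \<le> a * r\<^sup>2" "\<And>j. \<bar>u (x + d j) - v (x + d j)\<bar> \<le> a * r\<^sup>2"
  shows "norm (grad u x - grad v x) \<le> real CARD('n) * \<Lambda> * ((real CARD('n))\<^sup>2 * (Lu + Lv) + 2 * a) * r"
proof -
  define n where "n = real CARD('n)"
  define e where "e = (n\<^sup>2 * (Lu + Lv) + 2 * a) * r\<^sup>2"
  have "\<bar>(grad u x - grad v x) \<bullet> d j\<bar> \<le> e" for j
  proof -
    have "norm (d j) \<le> n * r"
      unfolding n_def using norm_le_tr_norm[OF tr] d by (meson mult_left_mono of_nat_0_le_iff order_trans)
    then have "(norm (d j))\<^sup>2 \<le> (n * r)\<^sup>2" by (intro power_mono) auto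
    then have nd: "(Lu + Lv) * (norm (d j))\<^sup>2 \<le> (Lu + Lv) * (n * r)\<^sup>2"
      using L by (intro mult_left_mono) auto
    have "\<bar>u (x + d j) - u x - grad u x \<bullet> d j\<bar> \<le> Lu * (norm (d j))\<^sup>2"
      using taylor_Lipschitz_grad[of x "x + d j" u Lu] diff lip(1) L by simp
    moreover have "\<bar>v (x + d j) - v x - grad v x \<bullet> d j\<bar> \<le> Lv * (norm (d j))\<^sup>2"
      using taylor_Lipschitz_grad[of x "x + d j" v Lv] diff lip(2) L by simp
    ultimately have "\<bar>(grad u x - grad v x) \<bullet> d j\<bar> \<le> (Lu + Lv) * (norm (d j))\<^sup>2 + 2 * (a * r\<^sup>2)"
      unfolding inner_diff_left distrib_right using a(1) a(2)[of j] by linarith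
    also have "\<dots> \<le> (Lu + Lv) * (n * r)\<^sup>2 + 2 * (a * r\<^sup>2)" using nd by simp
    also have "\<dots> = e" by (simp add: e_def algebra_simps power_mult_distrib)
    finally show ?thesis .
  qed
  from norm_le_if_inner_columns_le[OF inv this] have "norm (grad u x - grad v x) \<le> n * (\<Lambda> / r) * e"
    by (simp add: n_def)
  also have "\<dots> = n * \<Lambda> * (n\<^sup>2 * (Lu + Lv) + 2 * a) * r"
    using r by (simp add: e_def power2_eq_square)
  finally show ?thesis by (simp add: n_def)
qed

theorem theorem2p8:
  fixes tr :: real
    and xL xU :: "'n::finite \<Rightarrow> ereal"
    and \<Omega> X Lenl :: "(real ^ 'n) set"
    and Y :: "(real ^ 'p::finite) set"
    and F :: "real ^ 'n \<Rightarrow> real ^ 'p"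
    and h :: "real ^ 'p \<Rightarrow> real"
    and f :: "real ^ 'n \<Rightarrow> real"
    \<comment> \<open>constants of the smoothness assumptions\<close>
    and L_F L_dF L_dq \<kappa>_dih \<kappa>_dq :: "'p \<Rightarrow> real"
    and L_h L_dh \<kappa>_dh :: real
    \<comment> \<open>parameters of the algorithm\<close>
    and \<Delta>max \<gamma>dec \<gamma>inc \<eta> \<mu> \<epsilon>c \<kappa>app \<Lambda> c_app \<kappa>fcd \<kappa>bhm :: real
    \<comment> \<open>sequences generated by the algorithm\<close>
    and x s :: "nat \<Rightarrow> real ^ 'n"
    and \<Delta> \<delta> \<rho> \<pi>m :: "nat \<Rightarrow> real"
    and D :: "nat \<Rightarrow> 'n \<Rightarrow> real ^ 'n"
    and Ft :: "nat \<Rightarrow> 'p \<Rightarrow> real ^ 'n \<Rightarrow> real \<Rightarrow> real"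
    and q :: "nat \<Rightarrow> real ^ 'n \<Rightarrow> real ^ 'p"
    and m :: "nat \<Rightarrow> real ^ 'n \<Rightarrow> real"
  assumes tr: "tr \<ge> 1"
    and bounds: "\<And>j. xL j < xU j"
    and Omega: "\<Omega> = bound_box xL xU"
    and f: "f = (\<lambda>y. h (F y))"
    and Lenl: "Lenl = enlarged_level_set tr \<Delta>max f (x 0)"
    \<comment> \<open>the sets on which smoothness is assumed\<close>
    and X: "open X" "convex X" "Lenl \<inter> \<Omega> \<subseteq> X"
    and Y: "open Y" "convex Y" "F ` (Lenl \<inter> \<Omega>) \<subseteq> Y" "(\<Union>k. q k ` (Lenl \<inter> \<Omega>)) \<subseteq> Y"
    \<comment> \<open>smoothness of the inner function\<close>
    and F_const: "\<And>i. L_F i > 0" "\<And>i. L_dF i > 0"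
    and F_C1: "\<And>i. C1_on X (\<lambda>y. F y $ i)"
    and F_lip: "\<And>i y z. y \<in> X \<Longrightarrow> z \<in> X \<Longrightarrow> \<bar>F y $ i - F z $ i\<bar> \<le> L_F i * tr_norm tr (y - z)"
    and F_grad_lip: "\<And>i y z. y \<in> X \<Longrightarrow> z \<in> X \<Longrightarrow>
          tr_dual_norm tr (grad (\<lambda>y. F y $ i) y - grad (\<lambda>y. F y $ i) z) \<le> L_dF i * tr_norm tr (y - z)"
    \<comment> \<open>smoothness of the outer function\<close>
    and h_const: "L_h > 0" "L_dh > 0" "\<kappa>_dh > 0" "\<And>i. \<kappa>_dih i > 0"
    and h_C2: "C2_on Y h"
    and h_lip: "L_h-lipschitz_on Y h"
    and h_grad_lip: "L_dh-lipschitz_on Y (grad h)"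
    and h_grad_bound: "\<And>y. y \<in> Y \<Longrightarrow> norm (grad h y) \<le> \<kappa>_dh"
    and h_partial_bound: "\<And>y i. y \<in> Y \<Longrightarrow> \<bar>grad h y $ i\<bar> \<le> \<kappa>_dih i"
    \<comment> \<open>smoothness of the models, uniformly in the iteration\<close>
    and q_const: "\<And>i. L_dq i > 0" "\<And>i. \<kappa>_dq i > 0"
    and q_C2: "\<And>k i. C2_on X (\<lambda>y. q k y $ i)"
    and q_grad_lip: "\<And>k i y z. y \<in> X \<Longrightarrow> z \<in> X \<Longrightarrow>
          tr_dual_norm tr (grad (\<lambda>y. q k y $ i) y - grad (\<lambda>y. q k y $ i) z) \<le> L_dq i * tr_norm tr (y - z)"
    and q_grad_bound: "\<And>k i y. y \<in> X \<Longrightarrow> norm (grad (\<lambda>y. q k y $ i) y) \<le> \<kappa>_dq i"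
    and f_bdd_below: "bdd_below (f ` (Lenl \<inter> \<Omega>))"
    \<comment> \<open>parameters and initialization\<close>
    and par_\<Delta>: "0 < \<Delta>max" "0 < \<Delta> 0" "\<Delta> 0 \<le> \<Delta>max"
    and par_\<gamma>: "0 < \<gamma>dec" "\<gamma>dec < 1" "1 < \<gamma>inc"
    and par_\<eta>: "0 < \<eta>" "\<eta> < 1"
    and par_pos: "0 < \<mu>" "0 < \<epsilon>c" "0 < \<kappa>app" "0 < \<Lambda>"
    and par_c_app: "0 \<le> c_app"
    and par_\<kappa>fcd: "0 < \<kappa>fcd" "\<kappa>fcd \<le> 1"
    and x0: "x 0 \<in> \<Omega>"
    \<comment> \<open>accuracy, sample directions, approximate values, interpolation models\<close>
    and accuracy: "\<And>k. \<delta> k = c_app * (\<Delta> k)\<^sup>2"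
    and D_feas: "\<And>k j. tr_norm tr (D k j) \<le> \<Delta> k" "\<And>k j. x k + D k j \<in> \<Omega>"
    and D_inv: "\<And>k. invertible (column_matrix (D k))"
          "\<And>k. onorm ((*v) (matrix_inv (column_matrix (D k)))) \<le> \<Lambda> / \<Delta> k"
    and approx: "\<And>k i d. d \<in> range (D k) \<union> {0} \<Longrightarrow>
          \<bar>F (x k + d) $ i - Ft k i (x k + d) (\<delta> k)\<bar> \<le> \<kappa>app * \<delta> k"
    and interp: "\<And>k i d. d \<in> range (D k) \<union> {0} \<Longrightarrow>
          q k (x k + d) $ i = Ft k i (x k + d) (\<delta> k)"
    and model: "\<And>k. m k = quad_model h (q k) (x k)"
    and model_crit: "\<And>k. \<pi>m k = crit_measure tr \<Omega> (grad (m k) (x k)) (x k)"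
    and hess_bound: "0 < \<kappa>bhm" "\<And>k. tr_op_norm tr (hess (m k) (x k)) \<le> \<kappa>bhm"
    \<comment> \<open>criticality step\<close>
    and crit_step: "\<And>k. \<pi>m k \<le> \<epsilon>c \<and> \<Delta> k > \<mu> * \<pi>m k \<Longrightarrow>
          s k = 0 \<and> \<rho> k = 0 \<and> \<Delta> (Suc k) = \<gamma>dec * \<Delta> k \<and> x (Suc k) = x k"
    \<comment> \<open>trial step, then successful or unsuccessful update\<close>
    and trial_step: "\<And>k. \<not> (\<pi>m k \<le> \<epsilon>c \<and> \<Delta> k > \<mu> * \<pi>m k) \<Longrightarrow>
          tr_norm tr (s k) \<le> \<Delta> k \<and> x k + s k \<in> \<Omega> \<and>
          m k (x k) - m k (x k + s k) \<ge> \<kappa>fcd * \<pi>m k * Min {\<pi>m k / (\<kappa>bhm + 1), \<Delta> k, 1} \<and>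
          \<rho> k = (f (x k) - f (x k + s k)) / (m k (x k) - m k (x k + s k))"
    and success: "\<And>k. \<not> (\<pi>m k \<le> \<epsilon>c \<and> \<Delta> k > \<mu> * \<pi>m k) \<Longrightarrow> \<rho> k \<ge> \<eta> \<Longrightarrow>
          \<Delta> (Suc k) = min (\<gamma>inc * \<Delta> k) \<Delta>max \<and> x (Suc k) = x k + s k"
    and failure: "\<And>k. \<not> (\<pi>m k \<le> \<epsilon>c \<and> \<Delta> k > \<mu> * \<pi>m k) \<Longrightarrow> \<not> \<rho> k \<ge> \<eta> \<Longrightarrow>
          \<Delta> (Suc k) = \<gamma>dec * \<Delta> k \<and> x (Suc k) = x k"
  shows "(\<lambda>k. crit_measure tr \<Omega> (grad f (x k)) (x k)) \<longlonglongrightarrow> 0"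
proof -

  \<comment> \<open>Bookkeeping of the iteration: radii, feasibility, monotone objective\<close>
  define n where "n = real CARD('n)"
  have n: "n > 0" by (simp add: n_def)
  define \<phi> where "\<phi> k = f (x k)" for k
  define crit where "crit k \<longleftrightarrow> \<pi>m k \<le> \<epsilon>c \<and> \<Delta> k > \<mu> * \<pi>m k" for k
  \<comment> \<open>The complement joins criticality and unsuccessful steps: both shrink the radius
    and keep the iterate.\<close>
  define S where "S = {k. \<not> crit k \<and> \<rho> k \<ge> \<eta>}"
  have \<pi>0: "\<pi>m k \<ge> 0" for k by (simp add: model_crit crit_measure_def)
  define pred where "pred k = m k (x k) - m k (x k + s k)" for k
  define ared where "ared k = f (x k) - f (x k + s k)" for k
  have trial: "tr_norm tr (s k) \<le> \<Delta> k" "x k + s k \<in> \<Omega>"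
    "pred k \<ge> \<kappa>fcd * \<pi>m k * min (\<pi>m k / (\<kappa>bhm + 1)) (min (\<Delta> k) 1)" "\<rho> k = ared k / pred k"
    if "\<not> crit k" for k
    using trial_step[of k] that unfolding crit_def pred_def ared_def by auto
  have stepS: "\<Delta> (Suc k) = min (\<gamma>inc * \<Delta> k) \<Delta>max" "x (Suc k) = x k + s k" if "k \<in> S" for k
    using success[of k] that unfolding S_def crit_def by auto
  have stepN: "\<Delta> (Suc k) = \<gamma>dec * \<Delta> k" "x (Suc k) = x k" if "k \<notin> S" for k
    using failure[of k] crit_step[of k] that unfolding S_def crit_def by auto
  \<comment> \<open>Positivity of the radius is a premise here because it is established only by the
    induction \<open>inv\<close>, which in turn uses this decrease.\<close>
  have decrease: "\<eta> * pred k \<le> \<phi> k - f (x k + s k)" "pred k \<ge> 0" if "k \<in> S" "\<Delta> k > 0" for k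
  proof -
    have nc: "\<not> crit k" and \<rho>: "\<eta> \<le> \<rho> k" using that(1) by (auto simp: S_def)
    have "0 \<le> \<kappa>fcd * \<pi>m k * min (\<pi>m k / (\<kappa>bhm + 1)) (min (\<Delta> k) 1)"
      using \<pi>0[of k] par_\<kappa>fcd hess_bound(1) that(2) by simp
    then have p: "pred k \<ge> 0" using trial(3)[OF nc] by linarith
    \<comment> \<open>Division by 0 gives 0, so \<open>pred k = 0\<close> would mean
      \<open>\<rho> k = 0\<close>, against \<open>\<rho> k \<ge> \<eta> > 0\<close>.\<close>
    moreover have "pred k \<noteq> 0" using trial(4)[OF nc] \<rho> par_\<eta> by auto
    ultimately have "\<eta> * pred k \<le> ared k"
      using \<rho> by (simp add: trial(4)[OF nc] pos_le_divide_eq)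
    then show "\<eta> * pred k \<le> \<phi> k - f (x k + s k)" "pred k \<ge> 0"
      using p by (auto simp: ared_def \<phi>_def)
  qed
  have inv: "0 < \<Delta> k \<and> \<Delta> k \<le> \<Delta>max \<and> x k \<in> \<Omega> \<and> f (x k) \<le> f (x 0)" for k
  proof (induction k)
    case 0
    then show ?case using par_\<Delta> x0 by simp
  next
    case (Suc k)
    show ?case
    proof (cases "k \<in> S")
      case True
      have "0 \<le> \<eta> * pred k" using decrease(2)[OF True] Suc par_\<eta> by simp
      then have "f (x (Suc k)) \<le> f (x k)"
        using decrease(1)[OF True] Suc stepS(2)[OF True] by (simp add: \<phi>_def)
      moreover have "x (Suc k) \<in> \<Omega>" using True trial(2)[of k] stepS(2)[OF True] by (simp add: S_def)
      moreover have "0 < \<Delta> (Suc k)" "\<Delta> (Suc k) \<le> \<Delta>max"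
        using Suc par_\<Delta> par_\<gamma> by (auto simp: stepS(1)[OF True])
      ultimately show ?thesis using Suc by linarith
    next
      case False
      have "\<gamma>dec * \<Delta> k \<le> 1 * \<Delta> k" using Suc par_\<gamma> by (intro mult_right_mono) auto
      then have "\<gamma>dec * \<Delta> k \<le> \<Delta>max" using Suc by linarith
      then show ?thesis using Suc par_\<gamma> by (simp add: stepN[OF False])
    qed
  qed
  then have \<Delta>pos: "0 < \<Delta> k" and \<Delta>le: "\<Delta> k \<le> \<Delta>max" and x\<Omega>: "x k \<in> \<Omega>" and xlev: "f (x k) \<le> f (x 0)" for k
    by auto

  \<comment> \<open>Segments in the smoothness region and Lipschitz bounds in the Euclidean
    norm\<close>
  have seg: "z \<in> Lenl \<inter> \<Omega>" if "tr_norm tr d \<le> \<Delta> k" "x k + d \<in> \<Omega>" "z \<in> closed_segment (x k) (x k + d)" for k d z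
  proof -
    have "closed_segment (x k) (x k + d) \<subseteq> \<Omega>"
      using that(2) x\<Omega>[of k] convex_bound_box unfolding Omega by (intro closed_segment_subset) auto
    moreover have "closed_segment (x k) (x k + d) \<subseteq> Lenl"
      unfolding Lenl using that(1) \<Delta>le[of k]
      by (intro closed_segment_subset_enlarged_level_set tr xlev) auto
    ultimately show ?thesis using that(3) by blast
  qed
  have xL\<Omega>: "x k \<in> Lenl \<inter> \<Omega>" for k
    by (rule seg[of 0 k]) (use \<Delta>pos[of k] x\<Omega>[of k] in \<open>auto simp: tr_norm_zero tr\<close>)
  have xX: "x k \<in> X" and FY: "F (x k) \<in> Y" and qY: "q k (x k) \<in> Y" for k
    using xL\<Omega>[of k] X(3) Y(3,4) by blast+
  have norm_step: "norm v \<le> n * \<Delta> k" if "tr_norm tr v \<le> \<Delta> k" for v :: "real ^ 'n" and k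
    unfolding n_def using norm_le_tr_norm[OF tr] that by (meson mult_left_mono of_nat_0_le_iff order_trans)
  let ?gF = "\<lambda>i. grad (\<lambda>y. F y $ i)" and ?gq = "\<lambda>k i. grad (\<lambda>y. q k y $ i)"
  have dF: "(\<lambda>y. F y $ i) differentiable (at z)" if "z \<in> X" for i z
    using F_C1 that by (auto simp: C1_on_def)
  have dq: "(\<lambda>y. q k y $ i) differentiable (at z)" if "z \<in> X" for k i z
    using q_C2 that by (auto simp: C2_on_def C1_on_def)
  have dh: "h differentiable (at z)" if "z \<in> Y" for z
    using h_C2 that by (auto simp: C2_on_def C1_on_def)
  \<comment> \<open>One factor \<open>n\<close> comes from the dual norm on the left, the other from
    \<open>tr_norm\<close> on the right.\<close>
  have dual_lip: "norm u \<le> n\<^sup>2 * L * norm v" if "tr_dual_norm tr u \<le> L * tr_norm tr v" "L > 0"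
    for u v :: "real ^ 'n" and L
  proof -
    have "L * tr_norm tr v \<le> L * (n * norm v)"
      unfolding n_def using that(2) by (intro mult_left_mono tr_norm_le_norm tr) simp
    then have "tr_dual_norm tr u \<le> L * (n * norm v)" using that(1) by linarith
    then have "n * tr_dual_norm tr u \<le> n * (L * (n * norm v))" using n by simp
    then show ?thesis
      using norm_le_tr_dual_norm[OF tr, of u] unfolding n_def[symmetric] by (simp add: power2_eq_square mult_ac)
  qed
  define LF where "LF i = n\<^sup>2 * L_dF i" for i
  define Lq where "Lq i = n\<^sup>2 * L_dq i" for i
  have LF: "LF i \<ge> 0" and Lq: "Lq i \<ge> 0" for i
    using F_const(2)[of i] q_const(1)[of i] by (auto simp: LF_def Lq_def)
  have gF_lip: "norm (?gF i y - ?gF i z) \<le> LF i * norm (y - z)" if "y \<in> X" "z \<in> X" for i y z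
    unfolding LF_def by (rule dual_lip[OF F_grad_lip[OF that] F_const(2)])
  have gq_lip: "norm (?gq k i y - ?gq k i z) \<le> Lq i * norm (y - z)" if "y \<in> X" "z \<in> X" for k i y z
    unfolding Lq_def by (rule dual_lip[OF q_grad_lip[OF that] q_const(1)])
  define LFv where "LFv = (\<Sum>i\<in>UNIV. L_F i) * n"
  have LFv: "LFv \<ge> 0" unfolding LFv_def using n F_const(1) by (intro mult_nonneg_nonneg sum_nonneg less_imp_le)
  have F_norm_lip: "norm (F y - F z) \<le> LFv * norm (y - z)" if "y \<in> X" "z \<in> X" for y z
  proof -
    have "norm (F y - F z) \<le> (\<Sum>i\<in>UNIV. L_F i * (n * norm (y - z)))"
    proof (rule norm_vec_le_sum)
      fix i
      have "L_F i * tr_norm tr (y - z) \<le> L_F i * (n * norm (y - z))"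
        unfolding n_def using F_const(1)[of i] by (intro mult_left_mono tr_norm_le_norm tr) simp
      then show "\<bar>(F y - F z) $ i\<bar> \<le> L_F i * (n * norm (y - z))"
        using F_lip[OF that, of i] by simp
    qed
    then show ?thesis by (simp add: LFv_def sum_distrib_right mult.assoc)
  qed
  have gh_comp: "\<bar>grad h y $ i - grad h z $ i\<bar> \<le> L_dh * norm (y - z)" if "y \<in> Y" "z \<in> Y" for y z i
    using component_le_norm_cart[of "grad h y - grad h z" i] lipschitz_onD[OF h_grad_lip that]
    by (simp add: dist_norm)

  \<comment> \<open>Interpolation errors of the inner models\<close>
  define G where "G i = n * \<Lambda> * (n\<^sup>2 * (LF i + Lq i) + 2 * (\<kappa>app * c_app))" for i
  have G: "norm (?gF i (x k) - ?gq k i (x k)) \<le> G i * \<Delta> k" for i k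
    unfolding G_def n_def
  proof (rule interpolation_gradient_error[OF tr \<Delta>pos D_inv D_feas(1) _ _ _ LF Lq])
    fix j z assume "z \<in> closed_segment (x k) (x k + D k j)"
    then have z: "z \<in> X" using seg[OF D_feas] X(3) by blast
    show "(\<lambda>y. F y $ i) differentiable (at z) \<and> (\<lambda>y. q k y $ i) differentiable (at z)"
      using z dF dq by blast
    show "norm (?gF i z - ?gF i (x k)) \<le> LF i * norm (z - x k)" by (rule gF_lip[OF z xX])
    show "norm (?gq k i z - ?gq k i (x k)) \<le> Lq i * norm (z - x k)" by (rule gq_lip[OF z xX])
  next
    \<comment> \<open>The choice \<open>\<delta> k = c_app * (\<Delta> k)\<^sup>2\<close> is what
      makes the value error quadratic in the radius.\<close>
    show "\<bar>F (x k) $ i - q k (x k) $ i\<bar> \<le> \<kappa>app * c_app * (\<Delta> k)\<^sup>2"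
      using approx[of 0 k i] interp[of 0 k i] by (simp add: accuracy mult.assoc)
    show "\<bar>F (x k + D k j) $ i - q k (x k + D k j) $ i\<bar> \<le> \<kappa>app * c_app * (\<Delta> k)\<^sup>2" for j
      using approx[of "D k j" k i] interp[of "D k j" k i] by (simp add: accuracy mult.assoc)
  qed
  \<comment> \<open>The value error is quadratic in the radius; a linear bound is enough here, so
    one factor \<open>\<Delta> k\<close> is replaced by \<open>\<Delta>max\<close>.\<close>
  define V where "V = real CARD('p) * (\<kappa>app * c_app * \<Delta>max)"
  have V: "norm (F (x k) - q k (x k)) \<le> V * \<Delta> k" for k
  proof -
    have "norm (F (x k) - q k (x k)) \<le> (\<Sum>i::'p\<in>UNIV. \<kappa>app * c_app * \<Delta>max * \<Delta> k)"
    proof (rule norm_vec_le_sum)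
      fix i
      have "\<bar>(F (x k) - q k (x k)) $ i\<bar> \<le> \<kappa>app * c_app * (\<Delta> k * \<Delta> k)"
        using approx[of 0 k i] interp[of 0 k i] by (simp add: accuracy power2_eq_square mult.assoc)
      also have "\<dots> \<le> \<kappa>app * c_app * (\<Delta>max * \<Delta> k)"
        using par_pos par_c_app \<Delta>le[of k] \<Delta>pos[of k] by (intro mult_left_mono mult_right_mono) auto
      finally show "\<bar>(F (x k) - q k (x k)) $ i\<bar> \<le> \<kappa>app * c_app * \<Delta>max * \<Delta> k" by (simp add: mult.assoc)
    qed
    then show ?thesis by (simp add: V_def)
  qed

  \<comment> \<open>Gradients of the objective and of the quadratic models\<close>
  define gf where "gf k = grad f (x k)" for k
  define gm where "gm k = grad (m k) (x k)" for k
  have gf: "gf k = (\<Sum>i\<in>UNIV. grad h (F (x k)) $ i *\<^sub>R ?gF i (x k))" for k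
    unfolding gf_def f by (rule grad_compose[OF dF[OF xX] dh[OF FY]])
  have gm: "gm k = (\<Sum>i\<in>UNIV. grad h (q k (x k)) $ i *\<^sub>R ?gq k i (x k))" for k
    by (simp add: gm_def model grad_quad_model vgrad_mult[OF dq[OF xX]])
  \<comment> \<open>A bound on the gradients of \<open>F\<close> at the iterates, inherited from the
    models through \<open>G\<close>. The absolute value lets \<open>\<Delta>max\<close> replace
    \<open>\<Delta> k\<close> whatever the sign of \<open>G i\<close>.\<close>
  define BF where "BF i = \<kappa>_dq i + \<bar>G i\<bar> * \<Delta>max" for i
  have BF: "norm (?gF i (x k)) \<le> BF i" for i k
  proof -
    have "norm (?gF i (x k)) \<le> norm (?gq k i (x k)) + norm (?gF i (x k) - ?gq k i (x k))"
      by (metis norm_triangle_sub add.commute)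
    moreover have "G i * \<Delta> k \<le> \<bar>G i\<bar> * \<Delta>max"
      using \<Delta>le[of k] \<Delta>pos[of k] by (intro mult_mono) auto
    moreover have "norm (?gq k i (x k)) \<le> \<kappa>_dq i" by (rule q_grad_bound[OF xX])
    moreover have "norm (?gF i (x k) - ?gq k i (x k)) \<le> G i * \<Delta> k" by (rule G)
    ultimately show ?thesis unfolding BF_def by linarith
  qed
  \<comment> \<open>The first summand is due to evaluating \<open>grad h\<close> at
    \<open>q k (x k)\<close> instead of \<open>F (x k)\<close>, the second to the error of the inner
    gradients.\<close>
  define C1 where "C1 = (\<Sum>i\<in>UNIV. L_dh * V * \<kappa>_dq i + \<kappa>_dih i * G i)"
  have E1: "norm (gf k - gm k) \<le> C1 * \<Delta> k" for k
  proof -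
    have "norm (gf k - gm k) \<le> (\<Sum>i\<in>UNIV. L_dh * (V * \<Delta> k) * \<kappa>_dq i + \<kappa>_dih i * (G i * \<Delta> k))"
      unfolding gf gm
    proof (intro norm_sum_scaleR_diff_le q_grad_bound[OF xX] h_partial_bound[OF FY] G)
      fix i
      show "\<bar>grad h (F (x k)) $ i - grad h (q k (x k)) $ i\<bar> \<le> L_dh * (V * \<Delta> k)"
        using gh_comp[OF FY[of k] qY[of k], of i] mult_left_mono[OF V[of k], of L_dh] h_const(2) by linarith
    qed
    then show ?thesis unfolding C1_def sum_distrib_right by (simp add: algebra_simps)
  qed
  define Bf where "Bf = (\<Sum>i\<in>UNIV. \<kappa>_dih i * BF i)"
  have Bf: "norm (gf k) \<le> Bf" for k
    unfolding gf Bf_def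
  proof (rule sum_norm_le)
    fix i
    show "norm (grad h (F (x k)) $ i *\<^sub>R ?gF i (x k)) \<le> \<kappa>_dih i * BF i"
      using h_const(4)[of i] by (auto intro!: mult_mono h_partial_bound[OF FY] BF simp: less_imp_le)
  qed
  define C2 where "C2 = (\<Sum>i\<in>UNIV. L_dh * LFv * BF i + \<kappa>_dih i * LF i)"
  have gf_lip: "norm (gf j - gf k) \<le> C2 * norm (x j - x k)" for j k
  proof -
    have "norm (gf j - gf k) \<le> (\<Sum>i\<in>UNIV. L_dh * (LFv * norm (x j - x k)) * BF i + \<kappa>_dih i * (LF i * norm (x j - x k)))"
      unfolding gf
    proof (intro norm_sum_scaleR_diff_le BF h_partial_bound[OF FY] gF_lip[OF xX xX])
      fix i
      show "\<bar>grad h (F (x j)) $ i - grad h (F (x k)) $ i\<bar> \<le> L_dh * (LFv * norm (x j - x k))"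
        using gh_comp[OF FY[of j] FY[of k], of i] mult_left_mono[OF F_norm_lip[OF xX[of j] xX[of k]], of L_dh] h_const(2) by linarith
    qed
    then show ?thesis unfolding C2_def sum_distrib_right by (simp add: algebra_simps)
  qed
  have C2: "C2 \<ge> 0"
    unfolding C2_def using h_const(2,4) LFv LF order_trans[OF norm_ge_zero BF]
    by (auto intro!: sum_nonneg add_nonneg_nonneg mult_nonneg_nonneg simp: less_imp_le)

  \<comment> \<open>Comparison of the criticality measures\<close>
  define a where "a k = crit_measure tr \<Omega> (gf k) (x k)" for k
  have \<pi>m: "\<pi>m k = crit_measure tr \<Omega> (gm k) (x k)" for k by (simp add: model_crit gm_def)
  have crit_lip: "\<bar>crit_measure tr \<Omega> g y - crit_measure tr \<Omega> g' z\<bar>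
      \<le> n * norm (g - g') + max (norm g) (norm g') * norm (y - z)"
    if "y \<in> \<Omega>" "z \<in> \<Omega>" for g g' y z
  proof -
    have "crit_measure tr \<Omega> g y \<le> crit_measure tr \<Omega> g' z + n * norm (g - g') + norm g' * norm (y - z)"
      "crit_measure tr \<Omega> g' z \<le> crit_measure tr \<Omega> g y + n * norm (g - g') + norm g * norm (y - z)"
      using crit_measure_Lipschitz[OF tr, of y xL xU z g g'] crit_measure_Lipschitz[OF tr, of z xL xU y g' g] that
      by (auto simp: Omega n_def norm_minus_commute)
    moreover have "norm g' * norm (y - z) \<le> max (norm g) (norm g') * norm (y - z)"
      "norm g * norm (y - z) \<le> max (norm g) (norm g') * norm (y - z)"
      by (intro mult_right_mono; simp)+
    ultimately show ?thesis by linarith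
  qed
  have a_approx: "\<bar>a k - \<pi>m k\<bar> \<le> n * C1 * \<Delta> k" for k
  proof -
    have "\<bar>a k - \<pi>m k\<bar> \<le> n * norm (gf k - gm k)"
      using crit_lip[OF x\<Omega>[of k] x\<Omega>[of k], where g = "gf k" and g' = "gm k"] by (simp add: a_def \<pi>m)
    also have "\<dots> \<le> n * (C1 * \<Delta> k)" using E1 n by (intro mult_left_mono) auto
    finally show ?thesis by (simp add: mult.assoc)
  qed
  \<comment> \<open>\<open>n * C2\<close> accounts for the changing gradient, \<open>Bf\<close> for
    the shifted feasible steps, and the last \<open>n\<close> for
    \<open>norm (x (Suc k) - x k) \<le> n * \<Delta> k\<close>.\<close>
  define L where "L = (n * C2 + Bf) * n"
  have Bf0: "Bf \<ge> 0" using order_trans[OF norm_ge_zero Bf] .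
  have L0: "L \<ge> 0" using C2 Bf0 n by (simp add: L_def)
  have x_step: "norm (x (Suc k) - x k) \<le> n * \<Delta> k" for k
  proof (cases "k \<in> S")
    case True
    then show ?thesis using norm_step[OF trial(1)] stepS(2) by (simp add: S_def)
  next
    case False
    then show ?thesis using stepN(2) n \<Delta>pos[of k] by simp
  qed
  have a_lip: "\<bar>a (Suc k) - a k\<bar> \<le> L * \<Delta> k" for k
  proof -
    have "\<bar>a (Suc k) - a k\<bar> \<le> n * norm (gf (Suc k) - gf k) + max (norm (gf (Suc k))) (norm (gf k)) * norm (x (Suc k) - x k)"
      unfolding a_def by (rule crit_lip[OF x\<Omega> x\<Omega>])
    also have "\<dots> \<le> n * (C2 * norm (x (Suc k) - x k)) + Bf * norm (x (Suc k) - x k)"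
      using n gf_lip Bf by (intro add_mono mult_left_mono mult_right_mono) auto
    also have "\<dots> = (n * C2 + Bf) * norm (x (Suc k) - x k)" by (simp add: algebra_simps)
    also have "\<dots> \<le> (n * C2 + Bf) * (n * \<Delta> k)"
      using n C2 Bf0 x_step by (intro mult_left_mono) auto
    finally show ?thesis by (simp add: L_def mult.assoc)
  qed

  \<comment> \<open>Quadratic error of the model decrease\<close>
  define C3 where "C3 = L_dh * (LFv * n)\<^sup>2 + (\<Sum>i\<in>UNIV. \<kappa>_dih i * (LF i * n\<^sup>2)) + C1 * n + \<kappa>bhm / 2"
  \<comment> \<open>The sign is read off \<open>E1\<close>: at index 0 the product
    \<open>C1 * \<Delta> 0\<close> bounds a norm, and \<open>\<Delta> 0 > 0\<close>.\<close>
  have C1: "C1 \<ge> 0"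
    using order_trans[OF norm_ge_zero E1[of 0]] \<Delta>pos[of 0] by (simp add: zero_le_mult_iff)
  have C3: "C3 \<ge> 0"
    unfolding C3_def using C1 n h_const(2,4) LF hess_bound(1)
    by (auto intro!: add_nonneg_nonneg sum_nonneg mult_nonneg_nonneg simp: less_imp_le)
  \<comment> \<open>The summands of \<open>C3\<close> are, in order, the errors of linearizing
    \<open>h\<close>, linearizing \<open>F\<close>, replacing \<open>gf\<close> by
    \<open>gm\<close>, and dropping the curvature term of the model (\<open>e1\<close> to
    \<open>e4\<close>).\<close>
  have model_error: "\<bar>ared k - pred k\<bar> \<le> C3 * (\<Delta> k)\<^sup>2" if nc: "\<not> crit k" for k
  proof -
    have sX: "z \<in> X" if "z \<in> closed_segment (x k) (x k + s k)" for z
      using seg[OF trial(1,2)[OF nc] that] X(3) by blast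
    have s\<Omega>: "x k + s k \<in> Lenl \<inter> \<Omega>" using seg[OF trial(1,2)[OF nc]] by simp
    then have sY: "F (x k + s k) \<in> Y" and sX': "x k + s k \<in> X" using Y(3) X(3) by auto
    have ns: "norm (s k) \<le> n * \<Delta> k" by (rule norm_step[OF trial(1)[OF nc]])
    then have ns2: "(norm (s k))\<^sup>2 \<le> n\<^sup>2 * (\<Delta> k)\<^sup>2"
      using power_mono[OF ns, of 2] by (simp add: power_mult_distrib)
    let ?dF = "F (x k + s k) - F (x k)"
    have "norm ?dF \<le> LFv * (n * \<Delta> k)"
      using F_norm_lip[OF sX' xX[of k]] mult_left_mono[OF ns LFv] unfolding add_diff_cancel_left' by linarith
    then have "(norm ?dF)\<^sup>2 \<le> (LFv * n)\<^sup>2 * (\<Delta> k)\<^sup>2"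
      using power_mono[of "norm ?dF" "LFv * (n * \<Delta> k)" 2] by (simp add: power_mult_distrib mult.assoc)
    then have "L_dh * (norm ?dF)\<^sup>2 \<le> L_dh * ((LFv * n)\<^sup>2 * (\<Delta> k)\<^sup>2)"
      using h_const(2) by (intro mult_left_mono) auto
    moreover have "\<bar>h (F (x k + s k)) - h (F (x k)) - grad h (F (x k)) \<bullet> ?dF\<bar> \<le> L_dh * (norm ?dF)\<^sup>2"
    proof (rule taylor_Lipschitz_grad)
      fix z assume "z \<in> closed_segment (F (x k)) (F (x k + s k))"
      then have z: "z \<in> Y" using closed_segment_subset[OF FY sY Y(2)] by blast
      then show "h differentiable (at z)" by (rule dh)
      show "norm (grad h z - grad h (F (x k))) \<le> L_dh * norm (z - F (x k))"
        using lipschitz_onD[OF h_grad_lip z FY] by (simp add: dist_norm)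
    qed (use h_const(2) in simp)
    ultimately have e1: "\<bar>f (x k + s k) - f (x k) - grad h (F (x k)) \<bullet> ?dF\<bar> \<le> L_dh * (LFv * n)\<^sup>2 * (\<Delta> k)\<^sup>2"
      by (simp add: f mult.assoc)
    have e2: "\<bar>grad h (F (x k)) \<bullet> ?dF - gf k \<bullet> s k\<bar> \<le> (\<Sum>i\<in>UNIV. \<kappa>_dih i * (LF i * n\<^sup>2)) * (\<Delta> k)\<^sup>2"
    proof -
      have "grad h (F (x k)) \<bullet> ?dF - gf k \<bullet> s k
          = (\<Sum>i\<in>UNIV. grad h (F (x k)) $ i * (F (x k + s k) $ i - F (x k) $ i - ?gF i (x k) \<bullet> s k))"
        by (simp add: gf inner_vec_def[of "grad h _"] inner_sum_left sum_subtractf[symmetric] algebra_simps)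
      also have "\<bar>\<dots>\<bar> \<le> (\<Sum>i\<in>UNIV. \<kappa>_dih i * (LF i * n\<^sup>2 * (\<Delta> k)\<^sup>2))"
      proof (rule order_trans[OF sum_abs sum_mono])
        fix i
        have "\<bar>F (x k + s k) $ i - F (x k) $ i - ?gF i (x k) \<bullet> s k\<bar> \<le> LF i * (norm (s k))\<^sup>2"
          using taylor_Lipschitz_grad[of "x k" "x k + s k" "\<lambda>y. F y $ i" "LF i"]
            dF sX gF_lip[OF sX xX] LF by simp
        also have "\<dots> \<le> LF i * (n\<^sup>2 * (\<Delta> k)\<^sup>2)" by (rule mult_left_mono[OF ns2 LF])
        finally have "\<bar>F (x k + s k) $ i - F (x k) $ i - ?gF i (x k) \<bullet> s k\<bar> \<le> LF i * n\<^sup>2 * (\<Delta> k)\<^sup>2"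
          by (simp add: mult.assoc)
        then show "\<bar>grad h (F (x k)) $ i * (F (x k + s k) $ i - F (x k) $ i - ?gF i (x k) \<bullet> s k)\<bar>
            \<le> \<kappa>_dih i * (LF i * n\<^sup>2 * (\<Delta> k)\<^sup>2)"
          unfolding abs_mult using h_const(4)[of i] by (intro mult_mono h_partial_bound[OF FY]) auto
      qed
      finally show ?thesis by (simp add: sum_distrib_right mult.assoc)
    qed
    have e3: "\<bar>gf k \<bullet> s k - gm k \<bullet> s k\<bar> \<le> C1 * n * (\<Delta> k)\<^sup>2"
    proof -
      have "\<bar>(gf k - gm k) \<bullet> s k\<bar> \<le> norm (gf k - gm k) * norm (s k)" by (rule Cauchy_Schwarz_ineq2)
      also have "\<dots> \<le> (C1 * \<Delta> k) * (n * \<Delta> k)"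
        using E1[of k] ns C1 \<Delta>pos[of k] by (intro mult_mono) auto
      finally show ?thesis by (simp add: inner_diff_left power2_eq_square mult_ac)
    qed
    have "\<bar>s k \<bullet> (hess (m k) (x k) *v s k)\<bar> \<le> \<kappa>bhm * (\<Delta> k)\<^sup>2"
      by (rule quadratic_form_le_tr_op_norm[OF tr hess_bound(2) trial(1)[OF nc] \<Delta>pos])
    moreover have "- pred k = gm k \<bullet> s k + 1 / 2 * (s k \<bullet> (hess (m k) (x k) *v s k))"
      using quad_model_expansion[of h "q k" "x k" "s k"] by (simp add: pred_def gm_def model)
    ultimately have e4: "\<bar>pred k + gm k \<bullet> s k\<bar> \<le> \<kappa>bhm / 2 * (\<Delta> k)\<^sup>2" by linarith
    have "\<bar>ared k - pred k\<bar> \<le> L_dh * (LFv * n)\<^sup>2 * (\<Delta> k)\<^sup>2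
        + (\<Sum>i\<in>UNIV. \<kappa>_dih i * (LF i * n\<^sup>2)) * (\<Delta> k)\<^sup>2 + C1 * n * (\<Delta> k)\<^sup>2 + \<kappa>bhm / 2 * (\<Delta> k)\<^sup>2"
      using e1 e2 e3 e4 unfolding ared_def by linarith
    then show ?thesis by (simp add: C3_def distrib_right)
  qed

  \<comment> \<open>Verification of the abstract convergence hypotheses\<close>
  have "a \<longlonglongrightarrow> 0"
  proof (rule trust_region_criticality_tendsto_0[where \<pi> = \<pi>m and \<Delta> = \<Delta> and \<phi> = \<phi> and S = S and \<mu> = \<mu>
      and \<epsilon>c = \<epsilon>c and \<beta> = "\<kappa>bhm + 1" and c = "\<eta> * \<kappa>fcd"])
    show "a k \<ge> 0" for k by (simp add: a_def crit_measure_def)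
    show "\<pi>m k \<ge> 0" for k by (rule \<pi>0)
    show "\<Delta> k > 0" for k by (rule \<Delta>pos)
    show "0 < \<gamma>dec" "\<gamma>dec < 1" "1 < \<gamma>inc" "0 < \<mu>" "0 < \<epsilon>c" "0 < \<kappa>bhm + 1" "0 < \<eta> * \<kappa>fcd"
      using par_\<gamma> par_pos hess_bound(1) par_\<eta> par_\<kappa>fcd by auto
    have "range \<phi> \<subseteq> f ` (Lenl \<inter> \<Omega>)" using xL\<Omega> by (auto simp: \<phi>_def)
    then show "bdd_below (range \<phi>)" by (rule bdd_below_mono[OF f_bdd_below])
    show "\<bar>a k - \<pi>m k\<bar> \<le> n * C1 * \<Delta> k" for k by (rule a_approx)
    show "\<bar>a (Suc k) - a k\<bar> \<le> L * \<Delta> k" for k by (rule a_lip)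
    show "0 \<le> L" by (rule L0)
    show "\<Delta> (Suc k) = \<gamma>dec * \<Delta> k \<and> \<phi> (Suc k) = \<phi> k" if "k \<notin> S" for k
      using stepN[OF that] by (simp add: \<phi>_def)
    \<comment> \<open>Truncation at \<open>\<Delta>max\<close> cannot lower the radius, since
      \<open>\<Delta> k \<le> \<Delta>max\<close> already.\<close>
    show "\<Delta> k \<le> \<Delta> (Suc k) \<and> \<Delta> (Suc k) \<le> \<gamma>inc * \<Delta> k" if "k \<in> S" for k
      using stepS(1)[OF that] \<Delta>le[of k] \<Delta>pos[of k] par_\<gamma> by simp
    show "\<pi>m k > \<epsilon>c \<or> \<Delta> k \<le> \<mu> * \<pi>m k" if "k \<in> S" for k
      using that by (auto simp: S_def crit_def)
    \<comment> \<open>A success realizes at least the fraction \<open>\<eta>\<close> of the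
      predicted decrease, hence the constant \<open>\<eta> * \<kappa>fcd\<close>.\<close>
    show "\<eta> * \<kappa>fcd * \<pi>m k * min (\<pi>m k / (\<kappa>bhm + 1)) (min (\<Delta> k) 1) \<le> \<phi> k - \<phi> (Suc k)" if "k \<in> S" for k
    proof -
      have nc: "\<not> crit k" using that by (simp add: S_def)
      have "\<eta> * (\<kappa>fcd * \<pi>m k * min (\<pi>m k / (\<kappa>bhm + 1)) (min (\<Delta> k) 1)) \<le> \<eta> * pred k"
        using trial(3)[OF nc] par_\<eta> by (intro mult_left_mono) auto
      then show ?thesis
        using decrease(1)[OF that \<Delta>pos] stepS(2)[OF that] by (simp add: \<phi>_def mult.assoc)
    qed
  next
    fix e :: real assume e: "e > 0"
    \<comment> \<open>For \<open>\<Delta> k \<le> r\<close> the model error is at most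
      \<open>(1 - \<eta>) * (\<kappa>fcd * e * \<Delta> k)\<close>; \<open>\<eta> < 1\<close> makes
      \<open>r\<close> positive, and \<open>C3 + 1\<close> keeps the denominator away from
      0.\<close>
    define r where "r = (1 - \<eta>) * (\<kappa>fcd * e) / (C3 + 1)"
    \<comment> \<open>\<open>\<mu> * e\<close> rules out the criticality step, \<open>1\<close> and
      \<open>e / (\<kappa>bhm + 1)\<close> make the radius the active term of the minimum, and
      \<open>r\<close> forces \<open>\<rho> k \<ge> \<eta>\<close>.\<close>
    define t where "t = min (min (\<mu> * e) 1) (min (e / (\<kappa>bhm + 1)) r)"
    have r0: "r > 0" using e C3 par_\<eta> par_\<kappa>fcd by (simp add: r_def)
    have "t > 0" using e r0 par_pos hess_bound(1) by (simp add: t_def)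
    moreover have "k \<in> S" if k: "\<pi>m k \<ge> e" "\<Delta> k \<le> t" for k
    proof -
      have t: "\<Delta> k \<le> \<mu> * e" "\<Delta> k \<le> 1" "\<Delta> k \<le> e / (\<kappa>bhm + 1)" "\<Delta> k \<le> r"
        using k(2) by (auto simp: t_def)
      have "\<mu> * e \<le> \<mu> * \<pi>m k" using k(1) par_pos by simp
      then have nc: "\<not> crit k" using t(1) by (simp add: crit_def)
      have "e / (\<kappa>bhm + 1) \<le> \<pi>m k / (\<kappa>bhm + 1)" using k(1) hess_bound(1) by (intro divide_right_mono) auto
      then have "min (\<pi>m k / (\<kappa>bhm + 1)) (min (\<Delta> k) 1) = \<Delta> k" using t by linarith
      then have "pred k \<ge> \<kappa>fcd * \<pi>m k * \<Delta> k" using trial(3)[OF nc] by simp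
      moreover have "\<kappa>fcd * e * \<Delta> k \<le> \<kappa>fcd * \<pi>m k * \<Delta> k"
        using k(1) par_\<kappa>fcd \<Delta>pos[of k] by (intro mult_right_mono mult_left_mono) auto
      ultimately have p: "\<kappa>fcd * e * \<Delta> k \<le> pred k" by linarith
      have p0: "0 < pred k"
        using p mult_pos_pos[OF mult_pos_pos[OF par_\<kappa>fcd(1) e] \<Delta>pos[of k]] by linarith
      have "C3 * (\<Delta> k)\<^sup>2 \<le> (C3 + 1) * \<Delta> k * \<Delta> k"
        by (simp add: power2_eq_square algebra_simps)
      also have "\<dots> \<le> (C3 + 1) * r * \<Delta> k"
        using C3 t(4) \<Delta>pos[of k] by (intro mult_right_mono mult_left_mono) auto
      also have "\<dots> = (1 - \<eta>) * (\<kappa>fcd * e * \<Delta> k)" using C3 by (simp add: r_def)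
      also have "\<dots> \<le> (1 - \<eta>) * pred k" using p par_\<eta> by (intro mult_left_mono) auto
      finally have "\<eta> * pred k \<le> ared k"
        using model_error[OF nc] by (simp add: left_diff_distrib)
      then have "\<eta> \<le> \<rho> k" using p0 by (simp add: trial(4)[OF nc] pos_le_divide_eq)
      then show ?thesis using nc by (simp add: S_def)
    qed
    ultimately show "\<exists>t>0. \<forall>k. e \<le> \<pi>m k \<longrightarrow> \<Delta> k \<le> t \<longrightarrow> k \<in> S" by blast
  qed
  then show ?thesis by (simp add: a_def[abs_def] gf_def)
qed

end
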